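(* Let $a(t,x,\xi)$ be real-valued, smooth on $(-T,T)\times U\times(\mathbb{R}^d\setminus\{0\})$ and positively homogeneous of degree $2$ in $\xi$, where $T>0$ and $U$ is a neighborhood of $0\in\mathbb{R}^d$, and let $p(t,x,\tau,\xi)=-\tau^2+a(t,x,\xi)$. Assume that, for some $T_1>0$, $$a(t,x,\xi)\ge 0\quad\text{for all }(t,x,\xi)\in[0,T_1)\times U\times(\mathbb{R}^d\setminus\{0\}).$$ Let $\bar\xi\in\mathbb{R}^d\setminus\{0\}$ be such that $(t,x,\tau,\xi)=(0,0,0,\bar\xi)$ is a singular point of $p=0$, and suppose that this singular point is effectively hyperbolic. Then there exist a conic neighborhood $V$ of $(0,\bar\xi)$, a smooth function $\varphi(x,\xi)$ on $V$, homogeneous of degree $0$ in $\xi$, and constants $0<\kappa<1$, $c>0$, $\delta>0$ such that $$a(t,x,\xi)\ge c\,\min\big\{t^2,\,(t-\varphi(x,\xi))^2\big\}\,|\xi|^2,\qquad \{\varphi,a\}^2\le 4\kappa\, a$$ for all $(t,x,\xi)\in[0,\delta)\times V$. Moreover, for all $\alpha,\beta\in\mathbb{N}^d$ there is a constant $C_{\alpha\beta}$ such that $|\partial_x^\alpha\partial_\xi^\beta\varphi(x,\xi)|\le C_{\alpha\beta}\langle\xi\rangle^{-|\beta|}$ for all $(x,\xi)\in V$ with $|\xi|\ge 1$.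
   Context: Here $x,\xi\in\mathbb{R}^d$, $t,\tau\in\mathbb{R}$, $\langle\xi\rangle=(1+|\xi|^2)^{1/2}$, and $0\in\mathbb{N}$. "Conic" means invariant under $\xi\mapsto\lambda\xi$, $\lambda>0$. A singular point of $p=0$ is a point where $p$ and all its first order partial derivatives in $(t,x,\tau,\xi)$ vanish; for $(0,0,0,\bar\xi)$ this means that $a$ and all its first order derivatives in $(t,x,\xi)$ vanish at $(0,0,\bar\xi)$. Put $X=(t,x)\in\mathbb{R}^{d+1}$ and $\Xi=(\tau,\xi)\in\mathbb{R}^{d+1}$. The Hamilton map of $p$ at a singular point is the $(2d+2)\times(2d+2)$ matrix $$F_p=\frac12\begin{pmatrix}\partial^2p/\partial X\partial\Xi & \partial^2p/\partial\Xi\partial\Xi\\ -\partial^2p/\partial X\partial X & -\partial^2p/\partial\Xi\partial X\end{pmatrix}$$ evaluated at that point. A singular point is called effectively hyperbolic if $F_p$ at that point has a nonzero real eigenvalue. $\{\cdot,\cdot\}$ is the Poisson bracket in the variables $(x,\xi)$ (with $t$ as a parameter): $\{f,g\}=\sum_{j=1}^d\big(\partial_{\xi_j}f\,\partial_{x_j}g-\partial_{x_j}f\,\partial_{\xi_j}g\big)$. *)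

theory Defs
  imports "HOL-Analysis.Analysis"
begin

definition dir_deriv :: "'a::real_normed_vector \<Rightarrow> ('a \<Rightarrow> real) \<Rightarrow> 'a \<Rightarrow> real" where
  "dir_deriv v f z = frechet_derivative f (at z) v"

(* C^k on an open set; for k + 1: differentiable, with all directional derivatives of class C^k. *)
primrec Ck_on :: "nat \<Rightarrow> ('a::real_normed_vector \<Rightarrow> real) \<Rightarrow> 'a set \<Rightarrow> bool" where
  "Ck_on 0 f S \<longleftrightarrow> continuous_on S f"
| "Ck_on (Suc k) f S \<longleftrightarrow>
     (\<forall>z\<in>S. f differentiable (at z)) \<and> (\<forall>v. Ck_on k (dir_deriv v f) S)"

definition smooth_on :: "('a::real_normed_vector \<Rightarrow> real) \<Rightarrow> 'a set \<Rightarrow> bool" where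
  "smooth_on f S \<longleftrightarrow> (\<forall>k. Ck_on k f S)"

(* A point (x, xi) of phase space is an element of (real^'d) \<times> (real^'d). *)

definition dir_x :: "'d::finite \<Rightarrow> (real^'d) \<times> (real^'d)" where
  "dir_x j = (axis j 1, 0)"

definition dir_xi :: "'d::finite \<Rightarrow> (real^'d) \<times> (real^'d)" where
  "dir_xi j = (0, axis j 1)"

(* The iterated derivative with al j derivatives in direction e j.  The coordinate type 'd carries
   no order, so the derivatives are taken along an arbitrary fixed enumeration of it; for smooth
   functions the order is immaterial. *)
definition multi_deriv ::
    "('d::finite \<Rightarrow> 'a::real_normed_vector) \<Rightarrow> ('d \<Rightarrow> nat) \<Rightarrow> ('a \<Rightarrow> real) \<Rightarrow> 'a \<Rightarrow> real" where
  "multi_deriv e al =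
     fold (\<lambda>j. dir_deriv (e j) ^^ al j) (SOME js. distinct js \<and> set js = (UNIV :: 'd set))"

definition poisson ::
    "((real^'d) \<times> (real^'d) \<Rightarrow> real) \<Rightarrow> ((real^'d) \<times> (real^'d) \<Rightarrow> real)
      \<Rightarrow> (real^'d::finite) \<times> (real^'d) \<Rightarrow> real" where
  "poisson f g z = (\<Sum>j\<in>UNIV.
     dir_deriv (dir_xi j) f z * dir_deriv (dir_x j) g z
     - dir_deriv (dir_x j) f z * dir_deriv (dir_xi j) g z)"

(* Points (t, x, tau, xi).  The coordinates of X = (t, x) and Xi = (tau, xi) are indexed by
   'd option: None stands for t resp. tau, and Some j for x_j resp. xi_j. *)

type_synonym 'd cotangent = "real \<times> (real^'d) \<times> real \<times> (real^'d)"

fun dir_X :: "'d option \<Rightarrow> 'd::finite cotangent" where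
  "dir_X None = (1, 0, 0, 0)"
| "dir_X (Some j) = (0, axis j 1, 0, 0)"

fun dir_Xi :: "'d option \<Rightarrow> 'd::finite cotangent" where
  "dir_Xi None = (0, 0, 1, 0)"
| "dir_Xi (Some j) = (0, 0, 0, axis j 1)"

definition singular_point :: "('d::finite cotangent \<Rightarrow> real) \<Rightarrow> 'd cotangent \<Rightarrow> bool" where
  "singular_point p z \<longleftrightarrow>
     p z = 0 \<and> (\<forall>i. dir_deriv (dir_X i) p z = 0) \<and> (\<forall>i. dir_deriv (dir_Xi i) p z = 0)"

(* Inl indexes the first, Inr the second block of d + 1 coordinates.  A block d^2 p / dY dZ is the
   Jacobian matrix in Y of the gradient in Z (row index in Z, column index in Y), so that hamilton_map
   is half the linearization of the Hamilton field (dp/dXi, -dp/dX). *)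
definition hamilton_map ::
    "('d::finite cotangent \<Rightarrow> real) \<Rightarrow> 'd cotangent
      \<Rightarrow> real^('d option + 'd option)^('d option + 'd option)" where
  "hamilton_map p z = (\<chi> r c. (1/2) *
     (case (r, c) of
        (Inl i, Inl j) \<Rightarrow> dir_deriv (dir_X j) (dir_deriv (dir_Xi i) p) z
      | (Inl i, Inr j) \<Rightarrow> dir_deriv (dir_Xi j) (dir_deriv (dir_Xi i) p) z
      | (Inr i, Inl j) \<Rightarrow> - dir_deriv (dir_X j) (dir_deriv (dir_X i) p) z
      | (Inr i, Inr j) \<Rightarrow> - dir_deriv (dir_Xi j) (dir_deriv (dir_X i) p) z))"

definition real_eigenvalue :: "real^'n^'n \<Rightarrow> real \<Rightarrow> bool" where
  "real_eigenvalue A l \<longleftrightarrow> (\<exists>v. v \<noteq> 0 \<and> A *v v = l *\<^sub>R v)"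

definition effectively_hyperbolic :: "('d::finite cotangent \<Rightarrow> real) \<Rightarrow> 'd cotangent \<Rightarrow> bool" where
  "effectively_hyperbolic p z \<longleftrightarrow>
     singular_point p z \<and> (\<exists>l. l \<noteq> 0 \<and> real_eigenvalue (hamilton_map p z) l)"

definition conic_in_xi :: "((real^'d) \<times> (real^'d)) set \<Rightarrow> bool" where
  "conic_in_xi V \<longleftrightarrow> (\<forall>x xi. \<forall>l>0. (x, xi) \<in> V \<longrightarrow> (x, l *\<^sub>R xi) \<in> V)"

definition jap :: "'a::real_normed_vector \<Rightarrow> real" where
  "jap xi = sqrt (1 + (norm xi)\<^sup>2)"

end

theory Submission
  imports Defs
begin

text \<open>Write \<open>z = (x, \<xi>)\<close> and \<open>B\<close> for the Hessian of \<open>a\<close> at the singular point, which is positive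
  semidefinite.  A nonzero real eigenvalue \<open>\<lambda>\<close> of the Hamilton map forces \<open>\<partial>\<^sub>t\<^sup>2 a > 0\<close>, so that
  \<open>\<partial>\<^sub>t a = 0\<close> defines a smooth \<open>t = \<psi>(z)\<close> near the point.  If \<open>\<psi>(z) \<le> 0\<close>, convexity in \<open>t\<close> yields
  \<open>a \<ge> c t\<^sup>2\<close>; if \<open>\<psi>(z) \<ge> 0\<close>, it yields \<open>a \<ge> a(\<psi>(z), z) + c (t - \<psi>(z))\<^sup>2\<close>, and Glaeser's inequality at
  \<open>(\<psi>(z), z)\<close> allows to replace \<open>\<psi>\<close> by \<open>\<phi>(z) = \<psi>(z) - (\<partial>\<^sub>w a)(\<psi>(z), z) / 2\<close> for any fixed vector \<open>w\<close>.

  For fixed \<open>t \<ge> 0\<close> the function \<open>a(t, \<cdot>)\<close> is nonnegative, so Glaeser's inequality in the direction of the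
  Hamilton field \<open>n\<close> of \<open>\<phi>\<close> at the base point gives \<open>{\<phi>, a}\<^sup>2 \<le> 4 \<kappa> a\<close> with \<open>\<kappa> < 1\<close> as soon as \<open>B(n, n) < 2\<close>.
  This is achieved by the choice of \<open>w\<close>.  Let \<open>R\<close> be the Schur complement of \<open>\<partial>\<^sub>t\<^sup>2 a\<close> in \<open>B\<close> and \<open>G\<close> half its Hamilton map.
  As \<open>R \<ge> 0\<close>, the space is the direct sum of the kernel and the range of \<open>G\<^sup>2\<close>, and the range component of the
  Hamilton field of \<open>\<psi>\<close> can be removed.  The remaining kernel component \<open>n\<close> satisfies
  \<open>B(n, n) = R(n, n) \<le> R(z, z) = 2 - 4 \<lambda>\<^sup>2 / \<partial>\<^sub>t\<^sup>2 a < 2\<close>, where \<open>z\<close> is the phase space part of the eigenvector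
  for \<open>\<lambda>\<close>, normalised by \<open>t = - 1 / \<lambda>\<close>.\<close>

section \<open>Functions of class \<open>C\<^sup>k\<close>\<close>

lemma has_derivative_dir_deriv:
  "f differentiable (at z) \<Longrightarrow> (f has_derivative (\<lambda>v. dir_deriv v f z)) (at z)"
  unfolding dir_deriv_def by (simp add: frechet_derivative_works)

lemma dir_deriv_eq: "(f has_derivative D) (at z) \<Longrightarrow> dir_deriv v f z = D v"
  unfolding dir_deriv_def by (metis frechet_derivative_at)

lemma linear_dir_deriv: "f differentiable (at z) \<Longrightarrow> linear (\<lambda>v. dir_deriv v f z)"
  using has_derivative_dir_deriv has_derivative_linear by blast

lemma dir_deriv_cong_open:
  assumes "open S" "z \<in> S" "\<And>x. x \<in> S \<Longrightarrow> f x = g x"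
  shows "dir_deriv v f z = dir_deriv v g z"
proof -
  have "(f has_derivative D) (at z) \<longleftrightarrow> (g has_derivative D) (at z)" for D
    using has_derivative_transform_within_open[OF _ assms(1,2)] assms(3) by metis
  then show ?thesis by (simp add: dir_deriv_def frechet_derivative_def)
qed

lemma differentiable_cong_open:
  assumes "open S" "z \<in> S" "\<And>x. x \<in> S \<Longrightarrow> f x = g x" "f differentiable (at z)"
  shows "g differentiable (at z)"
  using assms has_derivative_transform_within_open unfolding differentiable_def by metis

lemma Ck_on_cong:
  assumes "open S" "\<And>x. x \<in> S \<Longrightarrow> f x = g x" "Ck_on k f S"
  shows "Ck_on k g S"
  using assms(2,3)
proof (induction k arbitrary: f g)
  case 0
  then show ?case by (simp cong: continuous_on_cong)
next
  case (Suc k)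
  have "g differentiable (at z)" if "z \<in> S" for z
    using differentiable_cong_open[OF assms(1) that Suc.prems(1)] Suc.prems(2) that by auto
  moreover have "Ck_on k (dir_deriv v g) S" for v
    using Suc.IH[of "dir_deriv v f"] Suc.prems dir_deriv_cong_open[OF assms(1) _ Suc.prems(1)]
    by simp
  ultimately show ?case by simp
qed

lemma Ck_on_subset: "Ck_on k f S \<Longrightarrow> T \<subseteq> S \<Longrightarrow> Ck_on k f T"
  by (induction k arbitrary: f) (auto intro: continuous_on_subset)

lemma Ck_on_Suc_imp: "Ck_on (Suc k) f S \<Longrightarrow> Ck_on k f S"
proof (induction k arbitrary: f)
  case 0
  then show ?case
    by (auto intro!: continuous_at_imp_continuous_on differentiable_imp_continuous_within)
next
  case (Suc k)
  then show ?case by (metis Ck_on.simps(2))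
qed

lemma Ck_on_const [simp]: "Ck_on k (\<lambda>z. c) S"
proof (induction k arbitrary: c)
  case (Suc k)
  have "dir_deriv v (\<lambda>z. c) = (\<lambda>z. 0)" for v :: 'a
    using dir_deriv_eq[OF has_derivative_const] by fastforce
  with Suc show ?case by simp
qed simp

lemma Ck_on_linear:
  assumes "bounded_linear f"
  shows "Ck_on k f S"
proof (cases k)
  case 0
  then show ?thesis using assms by (simp add: linear_continuous_on)
next
  case (Suc m)
  have "dir_deriv v f = (\<lambda>z. f v)" for v
    using dir_deriv_eq[OF bounded_linear_imp_has_derivative[OF assms]] by fastforce
  then show ?thesis using Suc assms by (simp add: bounded_linear_imp_differentiable)
qed

lemma dir_deriv_add:
  "f differentiable (at z) \<Longrightarrow> g differentiable (at z) \<Longrightarrow>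
    dir_deriv v (\<lambda>z. f z + g z) z = dir_deriv v f z + dir_deriv v g z"
  by (rule dir_deriv_eq[OF has_derivative_add[OF has_derivative_dir_deriv has_derivative_dir_deriv]])

lemma dir_deriv_mult:
  "f differentiable (at z) \<Longrightarrow> g differentiable (at z) \<Longrightarrow>
    dir_deriv v (\<lambda>z. f z * g z) z = f z * dir_deriv v g z + dir_deriv v f z * g z"
  by (rule dir_deriv_eq[OF has_derivative_mult[OF has_derivative_dir_deriv has_derivative_dir_deriv]])

lemma dir_deriv_inverse:
  assumes "f differentiable (at z)" "f z \<noteq> 0"
  shows "dir_deriv v (\<lambda>z. inverse (f z)) z = - 1 * (inverse (f z) * dir_deriv v f z * inverse (f z))"
  using dir_deriv_eq[OF Deriv.has_derivative_inverse[OF assms(2) has_derivative_dir_deriv[OF assms(1)]]]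
  by simp

lemma Ck_on_add:
  assumes "open S" "Ck_on k f S" "Ck_on k g S"
  shows "Ck_on k (\<lambda>z. f z + g z) S"
  using assms(2,3)
proof (induction k arbitrary: f g)
  case 0
  then show ?case by (simp add: continuous_on_add)
next
  case (Suc k)
  have "dir_deriv v f z + dir_deriv v g z = dir_deriv v (\<lambda>z. f z + g z) z" if "z \<in> S" for v z
    using Suc.prems that by (simp add: dir_deriv_add)
  then have "Ck_on k (dir_deriv v (\<lambda>z. f z + g z)) S" for v
    using Suc Ck_on_cong[OF assms(1), of "\<lambda>z. dir_deriv v f z + dir_deriv v g z"] by simp
  then show ?case using Suc.prems by auto
qed

lemma Ck_on_mult:
  assumes "open S" "Ck_on k f S" "Ck_on k g S"
  shows "Ck_on k (\<lambda>z. f z * g z) S"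
  using assms(2,3)
proof (induction k arbitrary: f g)
  case 0
  then show ?case by (simp add: continuous_on_mult)
next
  case (Suc k)
  have "f z * dir_deriv v g z + dir_deriv v f z * g z = dir_deriv v (\<lambda>z. f z * g z) z" if "z \<in> S" for v z
    using Suc.prems that by (simp add: dir_deriv_mult)
  moreover have "Ck_on k (\<lambda>z. f z * dir_deriv v g z + dir_deriv v f z * g z) S" for v
    using Suc.prems Ck_on_Suc_imp by (intro Ck_on_add assms(1) Suc.IH) auto
  ultimately have "Ck_on k (dir_deriv v (\<lambda>z. f z * g z)) S" for v
    using Ck_on_cong[OF assms(1), of "\<lambda>z. f z * dir_deriv v g z + dir_deriv v f z * g z"] by simp
  then show ?case using Suc.prems by auto
qed

lemma Ck_on_sum:
  assumes "open S" "\<And>i. i \<in> I \<Longrightarrow> Ck_on k (f i) S"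
  shows "Ck_on k (\<lambda>z. \<Sum>i\<in>I. f i z) S"
  using assms(2) by (induction I rule: infinite_finite_induct) (simp_all add: Ck_on_add[OF assms(1)])

lemma Ck_on_inverse:
  assumes "open S" "Ck_on k f S" "\<And>z. z \<in> S \<Longrightarrow> f z \<noteq> 0"
  shows "Ck_on k (\<lambda>z. inverse (f z)) S"
  using assms(2)
proof (induction k)
  case 0
  then show ?case using assms(3) by (simp add: continuous_on_inverse)
next
  case (Suc k)
  have "- 1 * (inverse (f z) * dir_deriv v f z * inverse (f z)) = dir_deriv v (\<lambda>z. inverse (f z)) z"
    if "z \<in> S" for v z
    using Suc.prems that assms(3) by (simp add: dir_deriv_inverse)
  moreover have "Ck_on k (\<lambda>z. - 1 * (inverse (f z) * dir_deriv v f z * inverse (f z))) S" for v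
    using Suc.prems Suc.IH Ck_on_Suc_imp by (intro Ck_on_mult assms(1) Ck_on_const) auto
  ultimately have "Ck_on k (dir_deriv v (\<lambda>z. inverse (f z))) S" for v
    using Ck_on_cong[OF assms(1), of "\<lambda>z. - 1 * (inverse (f z) * dir_deriv v f z * inverse (f z))"]
    by simp
  then show ?case using Suc.prems assms(3) by auto
qed

text \<open>The chain rule is written as a sum over \<open>Basis\<close> so that each summand is a
  product of scalar functions, the form to which \<open>Ck_on_sum\<close> and
  \<open>Ck_on_mult\<close> apply in \<open>Ck_on_compose\<close>.\<close>

lemma dir_deriv_compose:
  fixes f :: "'b::euclidean_space \<Rightarrow> real" and g :: "'a::real_normed_vector \<Rightarrow> 'b"
  assumes "f differentiable (at (g z))" "\<And>b. b \<in> Basis \<Longrightarrow> (\<lambda>z. g z \<bullet> b) differentiable (at z)"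
  shows "(\<lambda>z. f (g z)) differentiable (at z)"
    and "dir_deriv v (\<lambda>z. f (g z)) z =
           (\<Sum>b\<in>Basis. dir_deriv b f (g z) * dir_deriv v (\<lambda>z. g z \<bullet> b) z)"
proof -
  have g: "(g has_derivative (\<lambda>v. \<Sum>b\<in>Basis. dir_deriv v (\<lambda>z. g z \<bullet> b) z *\<^sub>R b)) (at z)"
    unfolding has_derivative_componentwise_within[of g]
    using assms(2) has_derivative_dir_deriv by (auto simp: inner_sum_left_Basis)
  have *: "((\<lambda>z. f (g z)) has_derivative
    (\<lambda>v. dir_deriv (\<Sum>b\<in>Basis. dir_deriv v (\<lambda>z. g z \<bullet> b) z *\<^sub>R b) f (g z))) (at z)"
    by (rule has_derivative_compose[OF g has_derivative_dir_deriv[OF assms(1)]])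
  then show "(\<lambda>z. f (g z)) differentiable (at z)" by (auto simp: differentiable_def)
  interpret linear "\<lambda>v. dir_deriv v f (g z)" by (rule linear_dir_deriv[OF assms(1)])
  show "dir_deriv v (\<lambda>z. f (g z)) z =
           (\<Sum>b\<in>Basis. dir_deriv b f (g z) * dir_deriv v (\<lambda>z. g z \<bullet> b) z)"
    unfolding dir_deriv_eq[OF *] by (simp add: sum scale mult.commute)
qed

text \<open>Induction on \<open>k\<close> with \<open>f\<close> arbitrary: by the chain rule, a
  derivative of the composition consists of directional derivatives of \<open>f\<close> along the
  same \<open>g\<close>, covered by the induction hypothesis, and of derivatives of the components
  of \<open>g\<close>.\<close>

lemma Ck_on_compose:
  fixes f :: "'b::euclidean_space \<Rightarrow> real" and g :: "'a::real_normed_vector \<Rightarrow> 'b"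
  assumes "open T" "g ` T \<subseteq> S" "\<And>b. b \<in> Basis \<Longrightarrow> Ck_on k (\<lambda>z. g z \<bullet> b) T" "Ck_on k f S"
  shows "Ck_on k (\<lambda>z. f (g z)) T"
  using assms(3,4)
proof (induction k arbitrary: f)
  case 0
  have "continuous_on T g"
    using 0(1) by (auto simp: continuous_on_componentwise[of T g])
  then show ?case
    using 0(2) assms(2) by (auto intro: continuous_on_compose2)
next
  case (Suc k)
  have d: "f differentiable (at (g z))" "\<And>b. b \<in> Basis \<Longrightarrow> (\<lambda>z. g z \<bullet> b) differentiable (at z)"
    if "z \<in> T" for z
    using Suc.prems that assms(2) by auto
  have "Ck_on k (\<lambda>z. dir_deriv b f (g z)) T" for b
    using Suc.IH[of "dir_deriv b f"] Suc.prems Ck_on_Suc_imp by (metis Ck_on.simps(2))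
  moreover have "Ck_on k (dir_deriv v (\<lambda>z. g z \<bullet> b)) T" if "b \<in> Basis" for b v
    using Suc.prems(1)[OF that] by simp
  ultimately have
    *: "Ck_on k (\<lambda>z. \<Sum>b\<in>Basis. dir_deriv b f (g z) * dir_deriv v (\<lambda>z. g z \<bullet> b) z) T" for v
    by (intro Ck_on_sum Ck_on_mult assms(1)) auto
  have "Ck_on k (dir_deriv v (\<lambda>z. f (g z))) T" for v
  proof (rule Ck_on_cong[OF assms(1) _ *])
    fix z assume "z \<in> T"
    from dir_deriv_compose(2)[OF d[OF this]]
    show "(\<Sum>b\<in>Basis. dir_deriv b f (g z) * dir_deriv v (\<lambda>z. g z \<bullet> b) z) =
      dir_deriv v (\<lambda>z. f (g z)) z" by simp
  qed
  moreover have "(\<lambda>z. f (g z)) differentiable (at z)" if "z \<in> T" for z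
    using dir_deriv_compose(1)[OF d[OF that]] .
  ultimately show ?case by simp
qed

lemma smooth_on_dir_deriv: "smooth_on f S \<Longrightarrow> smooth_on (dir_deriv v f) S"
  unfolding smooth_on_def by (metis Ck_on.simps(2))

lemma smooth_on_subset: "smooth_on f S \<Longrightarrow> T \<subseteq> S \<Longrightarrow> smooth_on f T"
  unfolding smooth_on_def by (metis Ck_on_subset)

lemma smooth_on_imp_differentiable: "smooth_on f S \<Longrightarrow> z \<in> S \<Longrightarrow> f differentiable (at z)"
  unfolding smooth_on_def by (metis Ck_on.simps(2))

lemma smooth_on_imp_continuous_on: "smooth_on f S \<Longrightarrow> continuous_on S f"
  unfolding smooth_on_def by (metis Ck_on.simps(1))

text \<open>Both sides of \<open>f (L x) = c * f x\<close> are differentiated. With a fibre dilation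
  as \<open>L\<close>, this determines how the derivatives of homogeneous functions scale.\<close>

lemma dir_deriv_scale:
  fixes f :: "'a::real_normed_vector \<Rightarrow> real"
  assumes "open S" "z \<in> S" "bounded_linear L" "\<And>x. x \<in> S \<Longrightarrow> f (L x) = c * f x"
    and "f differentiable (at z)" "f differentiable (at (L z))"
  shows "dir_deriv (L v) f (L z) = c * dir_deriv v f z"
proof -
  have "((\<lambda>x. f (L x)) has_derivative (\<lambda>v. dir_deriv (L v) f (L z))) (at z)"
    by (rule has_derivative_compose[OF bounded_linear_imp_has_derivative[OF assms(3)]
          has_derivative_dir_deriv[OF assms(6)]])
  then have "dir_deriv v (\<lambda>x. f (L x)) z = dir_deriv (L v) f (L z)"
    by (rule dir_deriv_eq)
  moreover have "dir_deriv v (\<lambda>x. f (L x)) z = dir_deriv v (\<lambda>x. c * f x) z"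
    by (rule dir_deriv_cong_open[OF assms(1,2,4)])
  moreover have "((\<lambda>x. c * f x) has_derivative (\<lambda>v. c * dir_deriv v f z)) (at z)"
    by (intro has_derivative_mult_right has_derivative_dir_deriv assms)
  ultimately show ?thesis by (simp add: dir_deriv_eq)
qed

lemma has_real_derivative_dir_deriv:
  assumes "f differentiable (at (z + s *\<^sub>R v))"
  shows "((\<lambda>s. f (z + s *\<^sub>R v)) has_real_derivative dir_deriv v f (z + s *\<^sub>R v)) (at s)"
proof -
  have "((\<lambda>s. z + s *\<^sub>R v) has_derivative (\<lambda>h. h *\<^sub>R v)) (at s)"
    by (auto intro!: derivative_eq_intros)
  from has_derivative_compose[OF this has_derivative_dir_deriv[OF assms]]
  have "((\<lambda>s. f (z + s *\<^sub>R v)) has_derivative (\<lambda>h. dir_deriv (h *\<^sub>R v) f (z + s *\<^sub>R v))) (at s)" .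
  moreover have "dir_deriv (h *\<^sub>R v) f (z + s *\<^sub>R v) = dir_deriv v f (z + s *\<^sub>R v) * h" for h
    using linear_scale[OF linear_dir_deriv[OF assms], of h v] by (simp add: mult.commute)
  ultimately show ?thesis by (simp add: has_field_derivative_def)
qed

section \<open>Taylor expansion and second derivatives\<close>

lemma taylor_second_order:
  fixes h h' h'' :: "real \<Rightarrow> real"
  assumes "\<And>t. t \<in> {a..b} \<Longrightarrow> (h has_real_derivative h' t) (at t)"
    and "\<And>t. t \<in> {a..b} \<Longrightarrow> (h' has_real_derivative h'' t) (at t)"
    and "c \<in> {a..b}" "x \<in> {a..b}"
  shows "\<exists>t\<in>{a..b}. h x = h c + h' c * (x - c) + h'' t / 2 * (x - c)\<^sup>2"
proof (cases "x = c")
  case False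
  define D where "D = (\<lambda>m::nat. if m = 0 then h else if m = 1 then h' else h'')"
  have "\<exists>t. (if x < c then x < t \<and> t < c else c < t \<and> t < x) \<and>
    h x = (\<Sum>m<2. D m c / fact m * (x - c) ^ m) + D 2 t / fact 2 * (x - c) ^ 2"
    by (rule Taylor[of 2 D h a b c x]) (use assms False in \<open>auto simp: D_def less_2_cases_iff\<close>)
  then obtain t where "if x < c then x < t \<and> t < c else c < t \<and> t < x"
    and "h x = h c + h' c * (x - c) + h'' t / 2 * (x - c)\<^sup>2"
    by (auto simp: D_def numeral_2_eq_2 lessThan_Suc)
  with assms(3,4) show ?thesis by (intro bexI[of _ t]) (auto split: if_splits)
qed (use assms in auto)

lemma half_quotient_mult: "k > 0 \<Longrightarrow> e / (2 * k) * k = e / (2::real)"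
  by simp

text \<open>The mean value theorem is used twice: along \<open>u\<close> for the increment of
  \<open>f\<close> in direction \<open>v\<close>, then along \<open>v\<close> for
  \<open>dir_deriv u f\<close>.\<close>

lemma second_difference:
  fixes f :: "'a::real_normed_vector \<Rightarrow> real"
  assumes s: "s > 0" and S: "\<And>a b. a \<in> {0..s} \<Longrightarrow> b \<in> {0..s} \<Longrightarrow> z + a *\<^sub>R u + b *\<^sub>R v \<in> S"
    and f: "Ck_on 2 f S"
  shows "\<exists>a\<in>{0..s}. \<exists>b\<in>{0..s}. f (z + s *\<^sub>R u + s *\<^sub>R v) - f (z + s *\<^sub>R u) - f (z + s *\<^sub>R v) + f z =
           s\<^sup>2 * dir_deriv v (dir_deriv u f) (z + a *\<^sub>R u + b *\<^sub>R v)"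
proof -
  have f1: "f differentiable (at y)" and f2: "dir_deriv u f differentiable (at y)" if "y \<in> S" for y
    using f that by (auto simp: numeral_2_eq_2)
  define h where "h = (\<lambda>a. f ((z + s *\<^sub>R v) + a *\<^sub>R u) - f (z + a *\<^sub>R u))"
  have "(h has_real_derivative
      dir_deriv u f ((z + s *\<^sub>R v) + a *\<^sub>R u) - dir_deriv u f (z + a *\<^sub>R u)) (at a)" if "0 \<le> a" "a \<le> s" for a
    unfolding h_def using S[of a s] S[of a 0] that s
    by (intro DERIV_diff has_real_derivative_dir_deriv f1) (auto simp: algebra_simps)
  from MVT2[OF s this] obtain a where a: "0 < a" "a < s"
    and h: "h s - h 0 = s * (dir_deriv u f ((z + s *\<^sub>R v) + a *\<^sub>R u) - dir_deriv u f (z + a *\<^sub>R u))"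
    by auto
  have "((\<lambda>b. dir_deriv u f ((z + a *\<^sub>R u) + b *\<^sub>R v)) has_real_derivative
      dir_deriv v (dir_deriv u f) ((z + a *\<^sub>R u) + b *\<^sub>R v)) (at b)" if "0 \<le> b" "b \<le> s" for b
    using S[of a b] that a by (intro has_real_derivative_dir_deriv f2) auto
  from MVT2[OF s this] obtain b where b: "0 < b" "b < s"
    and "dir_deriv u f ((z + a *\<^sub>R u) + s *\<^sub>R v) - dir_deriv u f (z + a *\<^sub>R u) =
      s * dir_deriv v (dir_deriv u f) ((z + a *\<^sub>R u) + b *\<^sub>R v)"
    by auto
  with h have "h s - h 0 = s\<^sup>2 * dir_deriv v (dir_deriv u f) (z + a *\<^sub>R u + b *\<^sub>R v)"
    by (simp add: power2_eq_square algebra_simps)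
  with a b show ?thesis
    by (intro bexI[of _ a] bexI[of _ b]) (auto simp: h_def algebra_simps)
qed

text \<open>The second difference over a small parallelogram is symmetric in \<open>u\<close> and
  \<open>v\<close>, and it is the same multiple of either mixed derivative at some point nearby. By
  continuity the two values at \<open>z\<close> cannot differ.\<close>

lemma dir_deriv_commute:
  fixes f :: "'a::real_normed_vector \<Rightarrow> real"
  assumes "open S" "z \<in> S" and f: "Ck_on 2 f S"
  shows "dir_deriv u (dir_deriv v f) z = dir_deriv v (dir_deriv u f) z"
proof (rule ccontr)
  define g1 where "g1 = dir_deriv u (dir_deriv v f)"
  define g2 where "g2 = dir_deriv v (dir_deriv u f)"
  assume "dir_deriv u (dir_deriv v f) z \<noteq> dir_deriv v (dir_deriv u f) z"
  then have e: "\<bar>g1 z - g2 z\<bar> / 2 > 0" (is "?e > 0") by (simp add: g1_def g2_def)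
  have "continuous_on S g1" "continuous_on S g2"
    using f by (auto simp: g1_def g2_def numeral_2_eq_2)
  then have "continuous (at z) g1" "continuous (at z) g2"
    using assms(1,2) continuous_on_eq_continuous_at by blast+
  then have "\<exists>d>0. \<forall>y. dist y z < d \<longrightarrow> dist (g1 y) (g1 z) < ?e"
    "\<exists>d>0. \<forall>y. dist y z < d \<longrightarrow> dist (g2 y) (g2 z) < ?e"
    using e unfolding continuous_at_eps_delta by blast+
  then obtain d1 d2 where d: "d1 > 0" "d2 > 0"
    "\<And>y. dist y z < d1 \<Longrightarrow> dist (g1 y) (g1 z) < ?e" "\<And>y. dist y z < d2 \<Longrightarrow> dist (g2 y) (g2 z) < ?e"
    by blast
  obtain r where r: "r > 0" "ball z r \<subseteq> S" using assms(1,2) open_contains_ball by blast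
  define q where "q = min r (min d1 d2)"
  \<comment> \<open>This side length keeps the parallelogram within distance \<open>q / 2\<close> of
    \<open>z\<close>; the summand 1 guards against \<open>u = v = 0\<close>.\<close>
  define s where "s = q / (2 * (norm u + norm v + 1))"
  have q: "q > 0" using r d by (simp add: q_def)
  have n: "norm u + norm v + 1 > 0" by (simp add: add_nonneg_pos)
  have s: "s > 0" unfolding s_def using q n by simp
  have near: "dist (z + a *\<^sub>R u + b *\<^sub>R v) z < q" if "a \<in> {0..s}" "b \<in> {0..s}" for a b
  proof -
    have "dist (z + a *\<^sub>R u + b *\<^sub>R v) z = norm (a *\<^sub>R u + b *\<^sub>R v)"
      by (simp add: dist_norm algebra_simps)
    also have "\<dots> \<le> a * norm u + b * norm v"
      using that norm_triangle_ineq[of "a *\<^sub>R u" "b *\<^sub>R v"] by simp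
    also have "\<dots> \<le> s * norm u + s * norm v"
      using that by (intro add_mono mult_right_mono) auto
    also have "\<dots> \<le> s * (norm u + norm v + 1)" using s by (simp add: algebra_simps)
    also have "\<dots> = q / 2" unfolding s_def by (rule half_quotient_mult[OF n])
    finally show ?thesis using q by simp
  qed
  have S: "z + a *\<^sub>R u + b *\<^sub>R v \<in> S" if "a \<in> {0..s}" "b \<in> {0..s}" for a b
    using near[OF that] r(2) by (auto simp: q_def dist_commute)
  from second_difference[OF s this f]
  obtain a b where 1: "a \<in> {0..s}" "b \<in> {0..s}"
    "f (z + s *\<^sub>R u + s *\<^sub>R v) - f (z + s *\<^sub>R u) - f (z + s *\<^sub>R v) + f z = s\<^sup>2 * g2 (z + a *\<^sub>R u + b *\<^sub>R v)"
    unfolding g2_def by blast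
  have "z + a *\<^sub>R v + b *\<^sub>R u \<in> S" if "a \<in> {0..s}" "b \<in> {0..s}" for a b
    using S[OF that(2,1)] by (simp add: algebra_simps)
  from second_difference[OF s this f]
  obtain a' b' where 2: "a' \<in> {0..s}" "b' \<in> {0..s}"
    "f (z + s *\<^sub>R v + s *\<^sub>R u) - f (z + s *\<^sub>R v) - f (z + s *\<^sub>R u) + f z = s\<^sup>2 * g1 (z + a' *\<^sub>R v + b' *\<^sub>R u)"
    unfolding g1_def by blast
  have "s\<^sup>2 * g2 (z + a *\<^sub>R u + b *\<^sub>R v) = s\<^sup>2 * g1 (z + b' *\<^sub>R u + a' *\<^sub>R v)"
    using 1 2 by (simp add: algebra_simps)
  then have "g2 (z + a *\<^sub>R u + b *\<^sub>R v) = g1 (z + b' *\<^sub>R u + a' *\<^sub>R v)" using s by simp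
  moreover have "dist (g2 (z + a *\<^sub>R u + b *\<^sub>R v)) (g2 z) < ?e"
    using near[OF 1(1,2)] by (intro d) (simp add: q_def)
  moreover have "dist (g1 (z + b' *\<^sub>R u + a' *\<^sub>R v)) (g1 z) < ?e"
    using near[OF 2(2,1)] by (intro d) (simp add: q_def)
  ultimately show False by (simp add: dist_real_def) argo
qed

text \<open>Since the first derivative vanishes at \<open>z\<close>, a negative second derivative
  would make it negative just after \<open>z\<close>, and \<open>f\<close> would drop below
  \<open>f z\<close>. The one-sided form suits a symbol whose sign is known for nonnegative times
  only.\<close>

lemma second_dir_deriv_nonneg:
  fixes f :: "'a::real_normed_vector \<Rightarrow> real"
  assumes "open S" "z \<in> S" and f: "Ck_on 2 f S" and "dir_deriv u f z = 0"
    and r: "r > 0" and min: "\<And>s. 0 < s \<Longrightarrow> s < r \<Longrightarrow> f (z + s *\<^sub>R u) \<ge> f z"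
  shows "dir_deriv u (dir_deriv u f) z \<ge> 0"
proof (rule ccontr)
  assume neg: "\<not> dir_deriv u (dir_deriv u f) z \<ge> 0"
  have f1: "f differentiable (at y)" and f2: "dir_deriv u f differentiable (at y)" if "y \<in> S" for y
    using f that by (auto simp: numeral_2_eq_2)
  have "((\<lambda>s. dir_deriv u f (z + s *\<^sub>R u)) has_real_derivative
      dir_deriv u (dir_deriv u f) (z + 0 *\<^sub>R u)) (at 0)"
    using assms(2) f2 by (intro has_real_derivative_dir_deriv) simp
  from DERIV_neg_dec_right[OF this] neg assms(4) obtain d where d: "d > 0"
    "\<And>h. 0 < h \<Longrightarrow> h < d \<Longrightarrow> dir_deriv u f (z + h *\<^sub>R u) < 0"
    by auto
  obtain e where e: "e > 0" "ball z e \<subseteq> S" using assms(1,2) open_contains_ball by blast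
  define s where "s = min (min (r / 2) (d / 2)) (e / (2 * (norm u + 1)))"
  have n: "norm u + 1 > 0" by (simp add: add_nonneg_pos)
  have s: "s > 0" "s < r" "s < d" using r d e n by (auto simp: s_def)
  have "z + a *\<^sub>R u \<in> S" if "0 \<le> a" "a \<le> s" for a
  proof -
    have "dist (z + a *\<^sub>R u) z = a * norm u" using that by (simp add: dist_norm)
    also have "\<dots> \<le> s * (norm u + 1)" using that s n by (intro mult_mono) auto
    also have "\<dots> \<le> (e / (2 * (norm u + 1))) * (norm u + 1)"
      using n by (intro mult_right_mono) (auto simp: s_def)
    also have "\<dots> < e" unfolding half_quotient_mult[OF n] using e by simp
    finally show ?thesis using e by (auto simp: dist_commute)
  qed
  then have "((\<lambda>s. f (z + s *\<^sub>R u)) has_real_derivative dir_deriv u f (z + a *\<^sub>R u)) (at a)"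
    if "0 \<le> a" "a \<le> s" for a
    using that by (intro has_real_derivative_dir_deriv f1) auto
  from MVT2[OF s(1) this] obtain a where "0 < a" "a < s"
    "f (z + s *\<^sub>R u) - f (z + 0 *\<^sub>R u) = (s - 0) * dir_deriv u f (z + a *\<^sub>R u)"
    by blast
  moreover from this d(2)[of a] s have "s * dir_deriv u f (z + a *\<^sub>R u) < 0"
    by (auto intro: mult_pos_neg)
  ultimately show False using min[of s] s by auto
qed

section \<open>Glaeser's inequality\<close>

text \<open>The function is nonnegative at the minimiser \<open>- h' 0 / M\<close> of its quadratic
  majorant with leading coefficient \<open>M / 2\<close>; \<open>small\<close> places this point in
  the interval.\<close>

lemma glaeser_interval:
  fixes h h' h'' :: "real \<Rightarrow> real"
  assumes "\<And>t. t \<in> {-r..r} \<Longrightarrow> (h has_real_derivative h' t) (at t)"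
    and "\<And>t. t \<in> {-r..r} \<Longrightarrow> (h' has_real_derivative h'' t) (at t)"
    and nonneg: "\<And>t. t \<in> {-r..r} \<Longrightarrow> h t \<ge> 0"
    and M: "M > 0" "\<And>t. t \<in> {-r..r} \<Longrightarrow> h'' t \<le> M" and small: "\<bar>h' 0\<bar> \<le> M * r"
  shows "(h' 0)\<^sup>2 \<le> 2 * M * h 0"
proof -
  define s where "s = - h' 0 / M"
  have "\<bar>s\<bar> \<le> r" using M small by (simp add: s_def field_simps)
  then have s: "s \<in> {-r..r}" "0 \<in> {-r..r}" by auto
  from taylor_second_order[OF assms(1,2) s(2,1)] obtain t where t: "t \<in> {-r..r}"
    "h s = h 0 + h' 0 * (s - 0) + h'' t / 2 * (s - 0)\<^sup>2" by blast
  have "0 \<le> h s" using nonneg s by blast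
  also have "\<dots> \<le> h 0 + h' 0 * s + M / 2 * s\<^sup>2"
    unfolding t using M(2)[OF t(1)] by (auto intro: mult_right_mono)
  also have "\<dots> = h 0 - (h' 0)\<^sup>2 / (2 * M)"
    using M by (simp add: s_def field_simps power2_eq_square)
  finally show ?thesis using M by (simp add: field_simps)
qed

text \<open>\<open>A\<close> will be the half-space of nonnegative times; its invariance along
  \<open>w\<close> keeps the test segments where \<open>f\<close> is known to be nonnegative. The
  derivative along \<open>w\<close> vanishes at \<open>z0\<close>, so it is small enough nearby for
  \<open>glaeser_interval\<close>.\<close>

lemma glaeser_local:
  fixes f :: "'a::real_normed_vector \<Rightarrow> real"
  assumes "open S" "z0 \<in> S" and f: "Ck_on 2 f S" and "dir_deriv w f z0 = 0"
    and "dir_deriv w (dir_deriv w f) z0 < M" "0 < M"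
    and nonneg: "\<And>z. z \<in> S \<inter> A \<Longrightarrow> f z \<ge> 0"
    and A: "\<And>z s. z \<in> A \<Longrightarrow> z + s *\<^sub>R w \<in> A"
  shows "\<exists>e>0. \<forall>z\<in>ball z0 e \<inter> A. (dir_deriv w f z)\<^sup>2 \<le> 2 * M * f z"
proof -
  have f1: "f differentiable (at y)" and f2: "dir_deriv w f differentiable (at y)" if "y \<in> S" for y
    using f that by (auto simp: numeral_2_eq_2)
  have "continuous_on S (dir_deriv w (dir_deriv w f))" using f by (auto simp: numeral_2_eq_2)
  then have c2: "continuous (at z0) (dir_deriv w (dir_deriv w f))"
    using assms(1,2) continuous_on_eq_continuous_at by blast
  have c1: "continuous (at z0) (dir_deriv w f)"
    using f2[OF assms(2)] differentiable_imp_continuous_within by blast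
  obtain r0 where r0: "r0 > 0" "ball z0 r0 \<subseteq> S" using assms(1,2) open_contains_ball by blast
  obtain d where d: "d > 0"
    "\<And>y. dist y z0 < d \<Longrightarrow> dist (dir_deriv w (dir_deriv w f) y) (dir_deriv w (dir_deriv w f) z0)
      < M - dir_deriv w (dir_deriv w f) z0"
    using c2 assms(5) unfolding continuous_at_eps_delta by (meson diff_gt_0_iff_gt)
  define q where "q = min r0 d"
  have q: "q > 0" using r0 d by (simp add: q_def)
  have n: "norm w + 1 > 0" by (simp add: add_nonneg_pos)
  \<comment> \<open>Segments of half-length \<open>r\<close> around points within
    \<open>q / 2\<close> of \<open>z0\<close> stay in the ball of radius \<open>q\<close>, where the
    second derivative is below \<open>M\<close>. The radius \<open>d'\<close> then ensures the
    condition \<open>small\<close>.\<close>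
  define r where "r = q / (2 * (norm w + 1))"
  have r: "r > 0" using q n by (simp add: r_def)
  obtain d' where d': "d' > 0"
    "\<And>y. dist y z0 < d' \<Longrightarrow> dist (dir_deriv w f y) (dir_deriv w f z0) < M * r"
    using c1 \<open>0 < M\<close> r unfolding continuous_at_eps_delta by (meson mult_pos_pos)
  have "(dir_deriv w f z)\<^sup>2 \<le> 2 * M * f z" if z: "dist z z0 < min (q / 2) d'" "z \<in> A" for z
  proof -
    have near: "dist (z + s *\<^sub>R w) z0 < q" if "s \<in> {-r..r}" for s
    proof -
      have "dist (z + s *\<^sub>R w) z0 \<le> dist z z0 + norm (s *\<^sub>R w)"
        by (metis add.commute dist_commute dist_norm dist_triangle add_diff_cancel_left' norm_minus_commute)
      also have "norm (s *\<^sub>R w) \<le> r * (norm w + 1)"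
        using that r by (auto intro!: mult_mono)
      also have "\<dots> = q / 2" unfolding r_def by (rule half_quotient_mult[OF n])
      finally show ?thesis using z by simp
    qed
    have S: "z + s *\<^sub>R w \<in> S" if "s \<in> {-r..r}" for s
      using near[OF that] r0 by (auto simp: q_def dist_commute)
    have "(dir_deriv w f (z + 0 *\<^sub>R w))\<^sup>2 \<le> 2 * M * f (z + 0 *\<^sub>R w)"
    proof (rule glaeser_interval[where h = "\<lambda>s. f (z + s *\<^sub>R w)" and r = r
          and h' = "\<lambda>s. dir_deriv w f (z + s *\<^sub>R w)"
          and h'' = "\<lambda>s. dir_deriv w (dir_deriv w f) (z + s *\<^sub>R w)"])
      fix s assume s: "s \<in> {-r..r}"
      show "((\<lambda>s. f (z + s *\<^sub>R w)) has_real_derivative dir_deriv w f (z + s *\<^sub>R w)) (at s)"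
        using S[OF s] f1 by (intro has_real_derivative_dir_deriv)
      show "((\<lambda>s. dir_deriv w f (z + s *\<^sub>R w)) has_real_derivative
          dir_deriv w (dir_deriv w f) (z + s *\<^sub>R w)) (at s)"
        using S[OF s] f2 by (intro has_real_derivative_dir_deriv)
      show "0 \<le> f (z + s *\<^sub>R w)" using S[OF s] A z nonneg by blast
      show "dir_deriv w (dir_deriv w f) (z + s *\<^sub>R w) \<le> M"
        using d(2)[of "z + s *\<^sub>R w"] near[OF s] by (auto simp: q_def dist_real_def)
    next
      show "\<bar>dir_deriv w f (z + 0 *\<^sub>R w)\<bar> \<le> M * r"
        using d'(2)[of z] z assms(4) by (simp add: dist_real_def)
    qed fact
    then show ?thesis by simp
  qed
  then show ?thesis using q d' by (intro exI[of _ "min (q / 2) d'"]) (auto simp: dist_commute)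
qed

section \<open>Positive semidefinite quadratic forms on a symplectic space\<close>

text \<open>By \<open>ker\<close>, kernel and range meet only in 0, so \<open>K\<close> is injective
  on its finite-dimensional range and maps it onto itself. Hence \<open>K v = K (K u)\<close> for
  some \<open>u\<close>.\<close>

lemma range_inter_kernel_decomposition:
  fixes K :: "'a::euclidean_space \<Rightarrow> 'a"
  assumes K: "linear K" and ker: "\<And>x. K (K x) = 0 \<Longrightarrow> K x = 0"
  obtains u where "K (v - K u) = 0"
proof -
  interpret linear K by fact
  have inj: "inj_on K (range K)"
  proof (rule inj_onI)
    fix x y assume "x \<in> range K" "y \<in> range K" "K x = K y"
    then obtain x' y' where "x = K x'" "y = K y'" "K (K (x' - y')) = 0" by (auto simp: diff)
    with ker[of "x' - y'"] show "x = y" by (simp add: diff)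
  qed
  have sub: "subspace (range K)" "subspace (K ` range K)"
    using K linear_subspace_image subspace_UNIV by blast+
  have "dim (K ` range K) = dim (range K)"
    using inj sub by (intro dim_image_eq K) (metis span_eq_iff)
  then have "K ` range K = range K"
    by (intro subspace_dim_equal sub) auto
  then obtain u where "K v = K (K u)" by blast
  then show ?thesis by (intro that[of u]) (simp add: diff)
qed

text \<open>Otherwise the form at \<open>y + s *\<^sub>R x\<close> is affine in \<open>s\<close>
  with nonzero slope, and the value of \<open>s\<close> chosen below makes it equal to -1.\<close>

lemma psd_kernel:
  fixes R :: "'a::real_vector \<Rightarrow> 'a \<Rightarrow> real"
  assumes "bilinear R" and sym: "\<And>x y. R x y = R y x" and psd: "\<And>x. R x x \<ge> 0" and "R x x = 0"
  shows "R x y = 0"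
proof (rule ccontr)
  assume ne: "R x y \<noteq> 0"
  have "0 \<le> R (y + s *\<^sub>R x) (y + s *\<^sub>R x)" for s by (rule psd)
  also have "R (y + s *\<^sub>R x) (y + s *\<^sub>R x) = R y y + 2 * s * R x y" for s
    using assms(1,4) sym[of y x]
    by (simp add: bilinear_ladd bilinear_radd bilinear_lmul bilinear_rmul algebra_simps)
  finally have "0 \<le> R y y + 2 * s * R x y" for s .
  from this[of "- (R y y + 1) / (2 * R x y)"] show False
    using ne by (simp add: field_simps)
qed

text \<open>The symplectic form is \<open>x \<bullet> J y\<close>: \<open>J_skew\<close> makes it
  antisymmetric and \<open>J_J\<close> makes it nondegenerate.\<close>

locale symplectic_form =
  fixes J :: "'w::euclidean_space \<Rightarrow> 'w"
  assumes linear_J: "linear J" and J_J: "J (J x) = - x" and J_skew: "J x \<bullet> y = - (x \<bullet> J y)"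
begin

lemma nondegenerate:
  assumes "\<And>w. x \<bullet> J w = y \<bullet> J w"
  shows "x = y"
proof -
  have "x \<bullet> w = y \<bullet> w" for w using assms[of "- J w"] by (simp add: linear_neg[OF linear_J] J_J)
  then show ?thesis by (metis vector_eq_rdot)
qed

text \<open>The witness \<open>J g\<close> is the Hamilton vector of \<open>f\<close>, where
  \<open>g\<close> is the Riesz representative of \<open>f\<close>.\<close>

lemma represent:
  assumes "linear f"
  obtains n where "\<And>w. n \<bullet> J w = f w"
proof
  fix w
  define g where "g = (\<Sum>b\<in>Basis. f b *\<^sub>R b)"
  have "J g \<bullet> J w = g \<bullet> w" by (metis J_J J_skew inner_minus_right minus_minus)
  also have "\<dots> = f (\<Sum>b\<in>Basis. (w \<bullet> b) *\<^sub>R b)"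
    unfolding g_def linear_sum[OF assms] linear_scale[OF assms]
    by (simp add: inner_sum_left inner_sum_right inner_commute mult.commute)
  finally show "J g \<bullet> J w = f w" by (simp add: euclidean_representation)
qed

text \<open>\<open>G\<close> is half the linearised Hamilton field of the quadratic form with
  Hessian \<open>R\<close>, matching the factor 1/2 in \<open>hamilton_map\<close>.\<close>

lemma hamilton_operator:
  assumes R: "bilinear R"
  obtains G where "linear G" "\<And>x y. G x \<bullet> J y = R x y / 2"
proof -
  have "linear (\<lambda>y. R x y / 2)" for x
    using R by (auto intro!: linearI simp: bilinear_radd bilinear_rmul add_divide_distrib)
  then have "\<exists>n. \<forall>w. n \<bullet> J w = R x w / 2" for x by (meson represent)
  then obtain G where G: "\<And>x w. G x \<bullet> J w = R x w / 2" by metis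
  have "linear G"
  proof (rule linearI)
    show "G (x + y) = G x + G y" for x y
      by (rule nondegenerate)
        (simp add: G inner_add_left bilinear_ladd[OF R] add_divide_distrib)
    show "G (c *\<^sub>R x) = c *\<^sub>R G x" for c x
      by (rule nondegenerate) (simp add: G bilinear_lmul[OF R])
  qed
  with G show ?thesis by (rule that[rotated])
qed

text \<open>The component of \<open>h\<close> in the range of \<open>G\<^sup>2\<close> (the elliptic part of \<open>R\<close>) can be removed by adding
  \<open>R\<close>-derivatives to \<open>h\<close>; the component \<open>n\<close> that is left is bounded by the eigenvector \<open>z\<close>.\<close>

lemma reduce_to_kernel:
  assumes R: "bilinear R" and sym: "\<And>x y. R x y = R y x" and psd: "\<And>x. R x x \<ge> 0" and l: "l \<noteq> 0"
    and z: "\<And>w. z \<bullet> J w = h \<bullet> J w + R z w / (2 * l)"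
  obtains n w0 where "\<And>w. n \<bullet> J w = h \<bullet> J w - R w0 w / 2" "n \<bullet> J h = 0" "R n n \<le> R z z"
proof -
  obtain G where "linear G" and G: "\<And>x y. G x \<bullet> J y = R x y / 2"
    by (rule hamilton_operator[OF R]) blast
  interpret G: linear G by fact
  have skew: "x \<bullet> J y = - (y \<bullet> J x)" for x y by (metis J_skew inner_commute)
  have Gskew: "G x \<bullet> J y = - (x \<bullet> J (G y))" for x y
    using G[of x y] G[of y x] sym[of x y] skew[of "G y" x] by simp
  \<comment> \<open>Jordan chains of \<open>G\<close> for the eigenvalue 0 have length at most two:
    by skewness, \<open>G (G (G x)) = 0\<close> makes \<open>G x\<close> isotropic for
    \<open>R\<close>, and isotropic vectors of a semidefinite form lie in its radical.\<close>
  have ker3: "G (G x) = 0" if "G (G (G x)) = 0" for x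
  proof -
    have "R (G x) (G x) = 2 * (G (G x) \<bullet> J (G x))" by (simp add: G)
    also have "\<dots> = - 2 * (G (G (G x)) \<bullet> J x)"
      using Gskew[of "G (G x)" x] by simp
    finally have "R (G x) (G x) = 0" by (simp add: that)
    then have "R (G x) y = 0" for y by (rule psd_kernel[OF R sym psd])
    then show ?thesis by (intro nondegenerate) (simp add: G)
  qed
  have "linear (\<lambda>x. G (G x))" by (intro linearI) (simp_all add: G.add G.scale)
  \<comment> \<open>Two uses of \<open>ker3\<close> give the kernel condition for the square of
    \<open>G\<close>, so \<open>h\<close> splits into \<open>n\<close> in the kernel and
    \<open>G (G u)\<close> in the range of that square.\<close>
  moreover have "G (G x) = 0" if "G (G (G (G x))) = 0" for x using ker3 that by blast
  ultimately obtain u where u: "G (G (h - G (G u))) = 0"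
    by (rule range_inter_kernel_decomposition[of "\<lambda>x. G (G x)"])
  define n where "n = h - G (G u)"
  have n: "G (G n) = 0" using u by (simp add: n_def)
  have zG: "z = h + (1 / l) *\<^sub>R G z"
    by (rule nondegenerate) (simp add: z inner_add_left G)
  \<comment> \<open>\<open>k\<close> solves \<open>k = n + (1 / l) *\<^sub>R G k\<close>: the
    Neumann series stops after two terms because \<open>G (G n) = 0\<close>. The rest
    \<open>m\<close> solves the same equation with \<open>G (G u)\<close> in place of
    \<open>n\<close>.\<close>
  define k where "k = n + (1 / l) *\<^sub>R G n"
  define m where "m = z - k"
  have "l *\<^sub>R m - G m = l *\<^sub>R (z - (1 / l) *\<^sub>R G z) - l *\<^sub>R n + (1 / l) *\<^sub>R G (G n)"
    using l by (simp add: m_def k_def G.add G.diff G.scale algebra_simps)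
  also have "z - (1 / l) *\<^sub>R G z = h" using zG by (metis add_diff_cancel_right')
  finally have "l *\<^sub>R m - G m = l *\<^sub>R G (G u)"
    by (simp add: n_def u algebra_simps)
  then have "m = (1 / l) *\<^sub>R (G m + l *\<^sub>R G (G u))"
    using l by (metis diff_add_cancel add.commute scaleR_scaleR nonzero_divide_eq_eq scaleR_one)
  then have m1: "m = G (G u) + (1 / l) *\<^sub>R G m" using l by (simp add: scaleR_add_right add.commute)
  \<comment> \<open>Substituting \<open>m1\<close> into itself once exhibits \<open>m\<close> as the
    image of \<open>q\<close> under the square of \<open>G\<close>.\<close>
  define q where "q = u + (1 / l) *\<^sub>R G u + (1 / l\<^sup>2) *\<^sub>R m"
  have m: "m = G (G q)"
  proof -
    have "G m = G (G (G u)) + (1 / l) *\<^sub>R G (G m)" by (subst m1) (simp add: G.add G.scale)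
    then have "m = G (G u) + (1 / l) *\<^sub>R (G (G (G u)) + (1 / l) *\<^sub>R G (G m))"
      using m1 by metis
    then show ?thesis by (simp add: q_def G.add G.scale power2_eq_square scaleR_add_right add.assoc)
  qed
  \<comment> \<open>Kernel and range parts are \<open>R\<close>-orthogonal: skewness moves both
    factors \<open>G\<close> of \<open>m = G (G q)\<close> onto \<open>G k\<close>.\<close>
  have "G (G (G k)) = 0" by (simp add: k_def n G.add G.scale G.zero)
  then have km: "R k m = 0"
    using G[of k m] Gskew[of "G k" "G q"] Gskew[of "G (G k)" q] by (simp add: m)
  have "R k k = R n n"
  proof -
    have "R n (G n) = 0" using G[of "G n" n] sym[of n "G n"] by (simp add: n)
    moreover have "R (G n) (G n) = 0" using G[of "G n" "G n"] by (simp add: n)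
    ultimately show ?thesis
      unfolding k_def using sym[of "G n" n]
      by (simp add: bilinear_ladd[OF R] bilinear_radd[OF R] bilinear_lmul[OF R] bilinear_rmul[OF R])
  qed
  moreover have "R z z = R k k + 2 * R k m + R m m"
  proof -
    have "z = k + m" by (simp add: m_def)
    then show ?thesis using sym[of k m] by (simp add: bilinear_ladd[OF R] bilinear_radd[OF R])
  qed
  ultimately have le: "R n n \<le> R z z" using km psd[of m] by simp
  \<comment> \<open>The range of the square of \<open>G\<close> is also symplectically orthogonal to
    its kernel, and \<open>h\<close> differs from \<open>n\<close> by an element of that
    range.\<close>
  have "n \<bullet> J (G (G u)) = 0"
    using Gskew[of n "G u"] Gskew[of "G n" u] by (simp add: n)
  moreover have "n \<bullet> J n = 0" using skew[of n n] by simp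
  moreover have "J h = J n + J (G (G u))"
    using linear_add[OF linear_J, of n "G (G u)"] by (simp add: n_def)
  ultimately have "n \<bullet> J h = 0" by (simp add: inner_add_right)
  moreover have "n \<bullet> J w = h \<bullet> J w - R (G u) w / 2" for w
    by (simp add: n_def inner_diff_left G)
  ultimately show ?thesis using that le by blast
qed

text \<open>\<open>B\<close> is the Hessian in time and phase space, and \<open>(t, z)\<close> is
  the eigenvector after elimination of its \<open>\<tau>\<close> component. The formula for
  \<open>n\<close> is the differential of the phase in \<open>local_lower_bound\<close>, so
  \<open>n\<close> becomes the Hamilton vector of that phase.\<close>

lemma effectively_hyperbolic_reduction:
  fixes B :: "real \<times> 'w \<Rightarrow> real \<times> 'w \<Rightarrow> real"
  assumes B: "bilinear B" and sym: "\<And>u v. B u v = B v u" and psd: "\<And>u. B u u \<ge> 0"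
    and l: "l \<noteq> 0" and nz: "t \<noteq> 0 \<or> z \<noteq> 0"
    and tz: "2 * l\<^sup>2 * t = B (1, 0) (t, z)" and zz: "\<And>w. 2 * l * (z \<bullet> J w) = B (0, w) (t, z)"
  obtains n w0 where "B (1, 0) (1, 0) > 0" "B (0, n) (0, n) < 2"
    "\<And>w. n \<bullet> J w = - B (1, 0) (0, w) / B (1, 0) (1, 0)
        - (B (0, w) (0, w0) - B (1, 0) (0, w0) * B (1, 0) (0, w) / B (1, 0) (1, 0)) / 2"
proof -
  define \<alpha> where "\<alpha> = B (1, 0) (1, 0)"
  define b where "b = (\<lambda>w. B (1, 0) (0, w))"
  define C where "C = (\<lambda>w w'. B (0, w) (0, w'))"
  have split: "(s, w) = s *\<^sub>R (1, 0) + (0, w)" for s :: real and w :: 'w by simp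
  have B1: "B (1, 0) (s, w) = s * \<alpha> + b w" for s w
    by (subst split) (simp only: bilinear_radd[OF B] bilinear_rmul[OF B] \<alpha>_def b_def real_scaleR_def)
  have B2: "B (0, v) (s, w) = s * b v + C v w" for s v w
    unfolding split[of s w]
    by (simp only: bilinear_radd[OF B] bilinear_rmul[OF B] C_def b_def real_scaleR_def sym[of "(0, v)" "(1, 0)"])
  have B3: "B (r, v) (s, w) = r * (s * \<alpha> + b w) + s * b v + C v w" for r v s w
    by (subst split[of r v]) (simp only: bilinear_ladd[OF B] bilinear_lmul[OF B] B1 B2 real_scaleR_def)
  have pair: "(0, v + w) = (0 :: real, v) + (0, w)" "(0, c *\<^sub>R w) = c *\<^sub>R (0 :: real, w)"
    for v w :: 'w and c by simp_all
  have b: "linear b"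
    unfolding b_def
    by (intro linearI) (simp_all only: pair bilinear_radd[OF B] bilinear_rmul[OF B] real_scaleR_def)
  have Cb: "bilinear C"
    unfolding C_def bilinear_def
    by (intro conjI allI linearI) (simp_all only: pair bilinear_radd[OF B] bilinear_rmul[OF B]
        bilinear_ladd[OF B] bilinear_lmul[OF B] real_scaleR_def)
  have Csym: "C v w = C w v" for v w unfolding C_def by (rule sym)
  have Cpsd: "C w w \<ge> 0" for w unfolding C_def by (rule psd)
  have skew0: "z \<bullet> J z = 0" using J_skew[of z z] by (simp add: inner_commute)
  \<comment> \<open>If \<alpha> vanished, \<open>(1, 0)\<close> would lie in the radical of
    \<open>B\<close>, and the equations would force successively \<open>t = 0\<close>,
    \<open>C z z = 0\<close> and \<open>z = 0\<close>, against \<open>nz\<close>.\<close>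
  have \<alpha>: "\<alpha> > 0"
  proof (rule ccontr)
    assume "\<not> \<alpha> > 0"
    then have 0: "B (1, 0) (1, 0) = 0" using psd[of "(1, 0)"] by (simp add: \<alpha>_def)
    then have b0: "b w = 0" for w
      unfolding b_def by (rule psd_kernel[OF B sym psd])
    have "\<alpha> = 0" using 0 by (simp add: \<alpha>_def)
    then have "t = 0" using tz l b0[of z] by (simp add: B1)
    have "C z z = 0" using zz[of z] skew0 b0 by (simp add: B2)
    then have "C z w = 0" for w by (rule psd_kernel[OF Cb Csym Cpsd])
    then have "z \<bullet> J w = 0" for w using zz[of w] l b0 Csym by (simp add: B2)
    then have "z = 0" by (intro nondegenerate) simp
    with \<open>t = 0\<close> nz show False by simp
  qed
  \<comment> \<open>The Schur complement of \<alpha>: \<open>R w w\<close> is the value of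
    \<open>B\<close> at \<open>(- b w / \<alpha>, w)\<close>, hence nonnegative.\<close>
  define R where "R = (\<lambda>v w. C v w - b v * b w / \<alpha>)"
  have R: "bilinear R"
    unfolding R_def bilinear_def
    by (intro conjI allI linearI) (simp_all add: bilinear_radd[OF Cb] bilinear_rmul[OF Cb]
        bilinear_ladd[OF Cb] bilinear_lmul[OF Cb] linear_add[OF b] linear_scale[OF b]
        distrib_left distrib_right right_diff_distrib add_divide_distrib)
  have Rsym: "R v w = R w v" for v w by (simp add: R_def Csym[of v w] mult.commute)
  have Rpsd: "R w w \<ge> 0" for w
  proof -
    have "0 \<le> B (- b w / \<alpha>, w) (- b w / \<alpha>, w)" by (rule psd)
    also have "\<dots> = R w w" using \<alpha> by (simp add: B3 R_def)
    finally show ?thesis .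
  qed
  have t1: "2 * l\<^sup>2 * t = t * \<alpha> + b z" using tz by (simp add: B1)
  have zz': "2 * l * (z \<bullet> J w) = R z w + b w * (2 * l\<^sup>2 * t) / \<alpha>" for w
    unfolding t1 using zz[of w] \<alpha> Csym[of w z] by (simp add: B2 R_def field_simps)
  \<comment> \<open>For \<open>t = 0\<close>, testing \<open>zz'\<close> on \<open>z\<close> makes
    \<open>z\<close> isotropic for \<open>R\<close>, which again forces
    \<open>z = 0\<close>.\<close>
  have t: "t \<noteq> 0"
  proof
    assume "t = 0"
    then have "R z z = 0" using zz'[of z] skew0 by simp
    then have "R z w = 0" for w by (rule psd_kernel[OF R Rsym Rpsd])
    then have "z \<bullet> J w = 0" for w using zz'[of w] l \<open>t = 0\<close> by simp
    then have "z = 0" by (intro nondegenerate) simp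
    with \<open>t = 0\<close> nz show False by simp
  qed
  \<comment> \<open>\<open>h\<close> is the Hamilton vector of the implicitly defined zero of the
    time derivative, whose differential at the base point is
    \<open>- b w / \<alpha>\<close>.\<close>
  obtain h where h: "\<And>w. h \<bullet> J w = - b w / \<alpha>"
    by (rule represent[of "\<lambda>w. - b w / \<alpha>"])
      (auto intro!: linearI simp: linear_add[OF b] linear_scale[OF b] add_divide_distrib diff_divide_distrib)
  \<comment> \<open>The factor normalises the coefficient of \<open>h\<close> to 1, giving the
    equation that \<open>reduce_to_kernel\<close> expects.\<close>
  define z' where "z' = (- 1 / (l * t)) *\<^sub>R z"
  have z': "z' \<bullet> J w = h \<bullet> J w + R z' w / (2 * l)" for w
  proof -
    have "z \<bullet> J w = R z w / (2 * l) + b w * l * t / \<alpha>"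
      using zz'[of w] l by (simp add: field_simps power2_eq_square)
    moreover have *: "R z' w = - 1 / (l * t) * R z w" "z' \<bullet> J w = - 1 / (l * t) * (z \<bullet> J w)"
      unfolding z'_def by (simp_all only: bilinear_lmul[OF R] inner_scaleR_left real_scaleR_def)
    ultimately have "z' \<bullet> J w = - 1 / (l * t) * (R z w / (2 * l) + b w * l * t / \<alpha>)" by simp
    then show ?thesis
      unfolding h *(1) using l t \<alpha> by (simp add: field_simps)
  qed
  obtain n w0 where n: "\<And>w. n \<bullet> J w = h \<bullet> J w - R w0 w / 2" "n \<bullet> J h = 0" "R n n \<le> R z' z'"
    by (rule reduce_to_kernel[OF R Rsym Rpsd l z']) blast
  \<comment> \<open>Symplectic orthogonality of \<open>n\<close> and \<open>h\<close> means
    \<open>b n = 0\<close>, so the correction in the Schur complement disappears at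
    \<open>n\<close>.\<close>
  have "b n = 0"
  proof -
    have "h \<bullet> J n = 0" using n(2) J_skew[of h n] by (simp add: inner_commute)
    then show ?thesis using h[of n] \<alpha> by simp
  qed
  then have "B (0, n) (0, n) = R n n" by (simp add: B2 R_def)
  moreover have "R z' z' < 2"
  proof -
    \<comment> \<open>The value of \<open>b z'\<close> comes from \<open>t1\<close>. Testing the
      equation for \<open>z'\<close> on \<open>z'\<close> itself cancels the symplectic terms and
      expresses \<open>R z' z'\<close> through \<open>b z'\<close>.\<close>
    have "b z' = - (2 * l\<^sup>2 - \<alpha>) / l"
      unfolding z'_def linear_scale[OF b] using t1 t l by (simp add: field_simps)
    moreover have "z' \<bullet> J z' = 0" using J_skew[of z' z'] by (simp add: inner_commute)
    then have "R z' z' = 2 * l * b z' / \<alpha>"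
      using z'[of z'] l \<alpha> by (simp add: h field_simps)
    ultimately have "R z' z' = 2 - 4 * l\<^sup>2 / \<alpha>" using l \<alpha> by (simp add: field_simps)
    then show ?thesis using l \<alpha> by simp
  qed
  ultimately have "B (0, n) (0, n) < 2" using n(3) by simp
  moreover have "n \<bullet> J w = - B (1, 0) (0, w) / B (1, 0) (1, 0)
        - (B (0, w) (0, w0) - B (1, 0) (0, w0) * B (1, 0) (0, w) / B (1, 0) (1, 0)) / 2" for w
    using n(1)[of w] Rsym[of w0 w] h[of w] by (simp add: R_def b_def C_def \<alpha>_def mult.commute)
  ultimately show ?thesis using that \<alpha> by (simp add: \<alpha>_def)
qed

end

section \<open>The zero of the time derivative\<close>

lemma Ck_on_graph:
  fixes \<psi> :: "'a::euclidean_space \<Rightarrow> real" and f :: "real \<times> 'a \<Rightarrow> real"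
  assumes "open N" "Ck_on k \<psi> N" "Ck_on k f S" "\<And>z. z \<in> N \<Longrightarrow> (\<psi> z, z) \<in> S"
  shows "Ck_on k (\<lambda>z. f (\<psi> z, z)) N"
proof (rule Ck_on_compose[OF assms(1) _ _ assms(3)])
  show "(\<lambda>z. (\<psi> z, z)) ` N \<subseteq> S" using assms(4) by auto
  fix b :: "real \<times> 'a"
  have "Ck_on k (\<lambda>z. z \<bullet> snd b) N" by (intro Ck_on_linear bounded_linear_inner_left)
  then have "Ck_on k (\<lambda>z. \<psi> z * fst b + z \<bullet> snd b) N"
    by (intro Ck_on_add Ck_on_mult Ck_on_const assms)
  then show "Ck_on k (\<lambda>z. (\<psi> z, z) \<bullet> b) N" by (simp add: inner_prod_def)
qed

lemma linear_split_fst: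
  fixes D :: "real \<times> 'a::real_vector \<Rightarrow> real"
  assumes "linear D"
  shows "D (c, v) = c * D (1, 0) + D (0, v)"
  using linear_add[OF assms, of "c *\<^sub>R (1, 0)" "(0, v)"] linear_scale[OF assms, of c "(1, 0)"] by simp

lemma dir_deriv_graph:
  fixes \<psi> :: "'a::real_normed_vector \<Rightarrow> real"
  assumes "\<psi> differentiable (at z)" "f differentiable (at (\<psi> z, z))"
  shows "dir_deriv v (\<lambda>z. f (\<psi> z, z)) z =
    dir_deriv v \<psi> z * dir_deriv (1, 0) f (\<psi> z, z) + dir_deriv (0, v) f (\<psi> z, z)"
proof -
  have "((\<lambda>z. (\<psi> z, z)) has_derivative (\<lambda>v. (dir_deriv v \<psi> z, v))) (at z)"
    by (intro has_derivative_Pair has_derivative_dir_deriv assms has_derivative_ident)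
  from has_derivative_compose[OF this has_derivative_dir_deriv[OF assms(2)]]
  have "dir_deriv v (\<lambda>z. f (\<psi> z, z)) z = dir_deriv (dir_deriv v \<psi> z, v) f (\<psi> z, z)"
    by (rule dir_deriv_eq)
  also have "\<dots> = dir_deriv v \<psi> z * dir_deriv (1, 0) f (\<psi> z, z) + dir_deriv (0, v) f (\<psi> z, z)"
    by (rule linear_split_fst[OF linear_dir_deriv[OF assms(2)]])
  finally show ?thesis .
qed

lemma has_real_derivative_fst_slice:
  assumes "f differentiable (at (t, z))"
  shows "((\<lambda>t. f (t, z)) has_real_derivative dir_deriv (1, 0) f (t, z)) (at t)"
  using has_real_derivative_dir_deriv[of f "(0, z)" t "(1, 0)"] assms by simp

text \<open>\<open>f\<close> will be the time derivative of the symbol. It increases strictly in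
  time, so \<psi> is its only zero on each slice.\<close>

context
  fixes f :: "real \<times> 'a::euclidean_space \<Rightarrow> real" and N :: "'a set" and r :: real
    and \<psi> :: "'a \<Rightarrow> real"
  assumes N: "open N" and f: "smooth_on f ({-r<..<r} \<times> N)"
    and pos: "\<And>p. p \<in> {-r<..<r} \<times> N \<Longrightarrow> dir_deriv (1, 0) f p > 0"
    and \<psi>: "\<And>z. z \<in> N \<Longrightarrow> \<psi> z \<in> {-r<..<r}" "\<And>z. z \<in> N \<Longrightarrow> f (\<psi> z, z) = 0"
begin

lemma fst_slice_strict_mono:
  assumes "z \<in> N" "-r < s" "s < t" "t < r"
  shows "f (s, z) < f (t, z)"
proof (rule DERIV_pos_imp_increasing[OF assms(3), where f = "\<lambda>t. f (t, z)"])
  fix x assume "s \<le> x" "x \<le> t"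
  then have "(x, z) \<in> {-r<..<r} \<times> N" using assms by auto
  then show "\<exists>y. ((\<lambda>t. f (t, z)) has_real_derivative y) (at x) \<and> 0 < y"
    using pos has_real_derivative_fst_slice smooth_on_imp_differentiable[OF f] by blast
qed

text \<open>The inverse function theorem is applied to \<Phi>, which replaces the time by the value
  of \<open>f\<close>. Monotonicity in time makes \<Phi> injective on the whole box, and
  \<open>\<psi> z\<close> is the first component of its inverse at \<open>(0, z)\<close>.\<close>

lemma implicit_function_has_derivative:
  assumes z: "z \<in> N"
  shows "(\<psi> has_derivative
    (\<lambda>v. - dir_deriv (0, v) f (\<psi> z, z) / dir_deriv (1, 0) f (\<psi> z, z))) (at z)"
proof -
  define S where "S = {-r<..<r} \<times> N"
  define \<Phi> where "\<Phi> = (\<lambda>p. (f p, snd p))"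
  define g where "g = inv_into S \<Phi>"
  define p where "p = (\<psi> z, z)"
  have S: "open S" "p \<in> S" using N \<psi> z by (auto simp: S_def p_def open_Times)
  have "inj_on \<Phi> S"
  proof (rule inj_onI)
    fix p q assume "p \<in> S" "q \<in> S" "\<Phi> p = \<Phi> q"
    then show "p = q"
      using fst_slice_strict_mono[of "snd p" "fst p" "fst q"]
        fst_slice_strict_mono[of "snd p" "fst q" "fst p"]
      by (cases p; cases q) (auto simp: S_def \<Phi>_def intro: linorder_cases)
  qed
  then have g: "g (\<Phi> q) = q" if "q \<in> S" for q using that by (simp add: g_def)
  have df: "f differentiable (at p)" using f S smooth_on_imp_differentiable by (simp add: S_def)
  have c: "continuous_on S \<Phi>"
    unfolding \<Phi>_def using smooth_on_imp_continuous_on[OF f]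
    by (intro continuous_intros) (simp add: S_def)
  have d: "(\<Phi> has_derivative (\<lambda>v. (dir_deriv v f p, snd v))) (at p)"
    unfolding \<Phi>_def by (intro has_derivative_Pair has_derivative_dir_deriv df)
      (auto intro!: derivative_eq_intros)
  have inv: "(\<lambda>v. (dir_deriv v f p, snd v)) \<circ>
      (\<lambda>y. ((fst y - dir_deriv (0, snd y) f p) / dir_deriv (1, 0) f p, snd y)) = id"
  proof
    fix y :: "real \<times> 'a"
    note linear_split_fst[OF linear_dir_deriv[OF df],
        of "(fst y - dir_deriv (0, snd y) f p) / dir_deriv (1, 0) f p" "snd y"]
    moreover have "dir_deriv (1, 0) f p > 0" using pos S by (simp add: S_def)
    ultimately show "((\<lambda>v. (dir_deriv v f p, snd v)) \<circ>
      (\<lambda>y. ((fst y - dir_deriv (0, snd y) f p) / dir_deriv (1, 0) f p, snd y))) y = id y" by simp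
  qed
  have "(g has_derivative
      (\<lambda>y. ((fst y - dir_deriv (0, snd y) f p) / dir_deriv (1, 0) f p, snd y))) (at (\<Phi> p))"
    using has_derivative_inverse_strong[where f = \<Phi> and g = g, OF S c _ d inv] g by blast
  moreover have "\<Phi> p = (0, z)" using \<psi>(2)[OF z] by (simp add: \<Phi>_def p_def)
  ultimately have g': "(g has_derivative
      (\<lambda>y. ((fst y - dir_deriv (0, snd y) f p) / dir_deriv (1, 0) f p, snd y))) (at (0, z))" by simp
  have "((\<lambda>z. (0::real, z)) has_derivative (\<lambda>v. (0, v))) (at z)"
    by (auto intro!: derivative_eq_intros)
  from has_derivative_fst[OF has_derivative_compose[OF this g']]
  have "((\<lambda>z. fst (g (0, z))) has_derivative (\<lambda>v. - dir_deriv (0, v) f p / dir_deriv (1, 0) f p)) (at z)"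
    by simp
  then show ?thesis
    unfolding p_def
  proof (rule has_derivative_transform_within_open[OF _ N z])
    fix x assume "x \<in> N"
    then have "g (0, x) = (\<psi> x, x)" using g[of "(\<psi> x, x)"] \<psi>[of x] by (simp add: S_def \<Phi>_def)
    then show "fst (g (0, x)) = \<psi> x" by simp
  qed
qed

text \<open>Bootstrapping: the derivative formula involves only derivatives of \<open>f\<close>
  along the graph of \<psi>, so each order of regularity of \<psi> yields the next.\<close>

lemma implicit_function_smooth: "smooth_on \<psi> N"
  unfolding smooth_on_def
proof
  fix k
  have d: "\<psi> differentiable (at z)" if "z \<in> N" for z
    using implicit_function_has_derivative[OF that] by (auto simp: differentiable_def)
  show "Ck_on k \<psi> N"
  proof (induction k)
    case 0
    then show ?case
      using d by (auto intro!: continuous_at_imp_continuous_on differentiable_imp_continuous_within)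
  next
    case (Suc k)
    have F: "Ck_on k (\<lambda>z. dir_deriv u f (\<psi> z, z)) N" for u
      using smooth_on_dir_deriv[OF f, of u] \<psi> Suc N
      by (intro Ck_on_graph[where S = "{-r<..<r} \<times> N"]) (auto simp: smooth_on_def)
    have "Ck_on k (\<lambda>z. - 1 * dir_deriv (0, v) f (\<psi> z, z) * inverse (dir_deriv (1, 0) f (\<psi> z, z))) N" for v
      using pos \<psi> by (intro Ck_on_mult Ck_on_inverse Ck_on_const F N) fastforce
    then have "Ck_on k (dir_deriv v \<psi>) N" for v
    proof (rule Ck_on_cong[OF N, rotated])
      fix z assume "z \<in> N"
      from dir_deriv_eq[OF implicit_function_has_derivative[OF this]]
      show "- 1 * dir_deriv (0, v) f (\<psi> z, z) * inverse (dir_deriv (1, 0) f (\<psi> z, z)) = dir_deriv v \<psi> z"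
        by (simp add: divide_inverse)
    qed
    then show ?case using d by simp
  qed
qed

end

text \<open>The direction \<open>w0\<close> is left free. It shifts the differential of the phase at
  \<open>z0\<close> by half the Schur complement of the Hessian applied to \<open>w0\<close>, while
  the lower bound persists; this freedom later makes the Hamilton vector short.\<close>

lemma local_lower_bound:
  fixes f :: "real \<times> 'a::euclidean_space \<Rightarrow> real" and w0 :: 'a
  defines "B \<equiv> \<lambda>u v z. dir_deriv u (dir_deriv v f) (0, z)"
  assumes T: "T > 0" and \<Omega>: "open \<Omega>" "z0 \<in> \<Omega>" and f: "smooth_on f ({-T<..<T} \<times> \<Omega>)"
    and nonneg: "\<And>t z. 0 \<le> t \<Longrightarrow> t < T \<Longrightarrow> z \<in> \<Omega> \<Longrightarrow> f (t, z) \<ge> 0"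
    and crit: "\<And>v. dir_deriv v f (0, z0) = 0"
    and \<alpha>: "B (1, 0) (1, 0) z0 > 0"
  obtains N \<phi> c r where "open N" "z0 \<in> N" "N \<subseteq> \<Omega>" "smooth_on \<phi> N" "c > 0" "0 < r" "r < T"
    "\<And>t z. 0 \<le> t \<Longrightarrow> t < r \<Longrightarrow> z \<in> N \<Longrightarrow> f (t, z) \<ge> c * min (t\<^sup>2) ((t - \<phi> z)\<^sup>2)"
    "\<And>v. dir_deriv v \<phi> z0 = - B (1, 0) (0, v) z0 / B (1, 0) (1, 0) z0
       - (B (0, v) (0, w0) z0 - B (1, 0) (0, w0) z0 * B (1, 0) (0, v) z0 / B (1, 0) (1, 0) z0) / 2"
proof -
  define S where "S = {-T<..<T} \<times> \<Omega>"
  define g where "g = dir_deriv (1, 0) f"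
  define h where "h = dir_deriv (1, 0) g"
  define F where "F = dir_deriv (0, w0) f"
  \<comment> \<open>Half the second time derivative at the base point bounds that derivative from
    below nearby.\<close>
  define m where "m = B (1, 0) (1, 0) z0 / 2"
  have S: "open S" "(0, z0) \<in> S" using \<Omega> T by (auto simp: S_def open_Times)
  have sf: "smooth_on f S" "smooth_on g S" "smooth_on h S" "smooth_on F S"
    using f by (auto simp: S_def g_def h_def F_def intro!: smooth_on_dir_deriv)
  have m: "m > 0" "h (0, z0) > m" using \<alpha> by (auto simp: m_def B_def h_def g_def)
  define M where "M = \<bar>B (0, w0) (0, w0) z0\<bar> + 1"
  have M: "M > 0" by (simp add: M_def)
  have "\<exists>e>0. \<forall>p\<in>ball (0, z0) e \<inter> {p. fst p \<ge> 0}. (dir_deriv (0, w0) f p)\<^sup>2 \<le> 2 * M * f p"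
  proof (rule glaeser_local[OF S])
    show "Ck_on 2 f S" using sf(1) by (simp add: smooth_on_def)
    show "dir_deriv (0, w0) (dir_deriv (0, w0) f) (0, z0) < M" by (simp add: M_def B_def)
  qed (use crit M nonneg in \<open>auto simp: S_def\<close>)
  then obtain e where e: "e > 0"
    "\<And>p. p \<in> ball (0, z0) e \<Longrightarrow> fst p \<ge> 0 \<Longrightarrow> (F p)\<^sup>2 \<le> 2 * M * f p"
    unfolding F_def by blast
  have "open (S \<inter> h -` {m<..})"
    using smooth_on_imp_continuous_on[OF sf(3)] S(1) open_greaterThan
    by (rule continuous_open_preimage)
  then have "open (S \<inter> h -` {m<..} \<inter> ball (0, z0) e)" by auto
  moreover have "(0, z0) \<in> S \<inter> h -` {m<..} \<inter> ball (0, z0) e" using S m e by simp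
  ultimately obtain A N1 where A: "open A" "open N1" "(0, z0) \<in> A \<times> N1"
    "A \<times> N1 \<subseteq> S \<inter> h -` {m<..} \<inter> ball (0, z0) e"
    by (rule open_prod_elim)
  then obtain q where q: "q > 0" "ball 0 q \<subseteq> A" using open_contains_ball[of A] by blast
  define r where "r = q / 2"
  have r: "0 < r" "r < q" using q by (auto simp: r_def)
  have box: "(t, z) \<in> S" "h (t, z) > m" "(t, z) \<in> ball (0, z0) e" if "-q < t" "t < q" "z \<in> N1" for t z
  proof -
    have "t \<in> ball 0 q" using that by (simp add: dist_real_def)
    then have "(t, z) \<in> A \<times> N1" using that q by blast
    with A(4) show "(t, z) \<in> S" "h (t, z) > m" "(t, z) \<in> ball (0, z0) e" by blast+
  qed
  have "q \<le> T"
  proof (rule ccontr)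
    assume "\<not> q \<le> T"
    then have "(T, z0) \<in> S" using box(1)[of T z0] A T by simp
    then show False by (simp add: S_def)
  qed
  have df: "((\<lambda>t. f (t, z)) has_real_derivative g (t, z)) (at t)"
    "((\<lambda>t. g (t, z)) has_real_derivative h (t, z)) (at t)" if "-q < t" "t < q" "z \<in> N1" for t z
    unfolding g_def h_def using sf box(1)[OF that]
    by (auto intro!: has_real_derivative_fst_slice smooth_on_imp_differentiable simp: g_def)
  have mono: "g (s, z) < g (t, z)" if "z \<in> N1" "-q < s" "s < t" "t < q" for s t z
  proof (rule DERIV_pos_imp_increasing[OF that(3), where f = "\<lambda>t. g (t, z)"])
    fix x assume "s \<le> x" "x \<le> t"
    then show "\<exists>y. ((\<lambda>t. g (t, z)) has_real_derivative y) (at x) \<and> 0 < y"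
      using that df(2)[of x z] box(2)[of x z] m(1) by (intro exI[of _ "h (x, z)"]) auto
  qed
  have g0: "g (0, z0) = 0" using crit by (simp add: g_def)
  \<comment> \<open>On \<open>N\<close> the time derivative has opposite signs at \<open>-r\<close>
    and \<open>r\<close>, so every slice contains a zero; it depends smoothly on \<open>z\<close> by
    the implicit function lemmas.\<close>
  define N where "N = N1 \<inter> (\<lambda>z. g (r, z)) -` {0<..} \<inter> (\<lambda>z. g (-r, z)) -` {..<0}"
  have cg: "continuous_on N1 (\<lambda>z. g (t, z))" if "-q < t" "t < q" for t
    by (rule continuous_on_compose2[OF smooth_on_imp_continuous_on[OF sf(2)], of _ "\<lambda>z. (t, z)"])
      (use box that in \<open>auto intro!: continuous_intros\<close>)
  have N: "open N"
  proof -
    have "open (N1 \<inter> (\<lambda>z. g (r, z)) -` {0<..})" "open (N1 \<inter> (\<lambda>z. g (-r, z)) -` {..<0})"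
      using cg[of r] cg[of "-r"] r A(2) by (auto intro!: continuous_open_preimage)
    then have "open ((N1 \<inter> (\<lambda>z. g (r, z)) -` {0<..}) \<inter> (N1 \<inter> (\<lambda>z. g (-r, z)) -` {..<0}))" by blast
    then show ?thesis by (simp add: N_def Int_ac)
  qed
  have z0: "z0 \<in> N"
    using A(3) mono[of z0 0 r] mono[of z0 "-r" 0] r g0 by (auto simp: N_def)
  have "\<exists>t. -r < t \<and> t < r \<and> g (t, z) = 0" if "z \<in> N" for z
  proof -
    have "continuous_on {-r..r} (\<lambda>t. g (t, z))"
    proof (rule DERIV_continuous_on)
      fix t assume "t \<in> {-r..r}"
      then show "((\<lambda>t. g (t, z)) has_real_derivative h (t, z)) (at t within {-r..r})"
        using df(2)[of t z] that r has_field_derivative_at_within by (auto simp: N_def)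
    qed
    then have "\<exists>t\<ge>-r. t \<le> r \<and> g (t, z) = 0"
      using that r by (intro IVT') (auto simp: N_def)
    then obtain t where "-r \<le> t" "t \<le> r" "g (t, z) = 0" by blast
    moreover from this that have "t \<noteq> r" "t \<noteq> -r" by (auto simp: N_def)
    ultimately show ?thesis by (intro exI[of _ t]) auto
  qed
  then obtain \<psi> where \<psi>: "\<And>z. z \<in> N \<Longrightarrow> -r < \<psi> z" "\<And>z. z \<in> N \<Longrightarrow> \<psi> z < r"
    "\<And>z. z \<in> N \<Longrightarrow> g (\<psi> z, z) = 0" by metis
  have NN1: "N \<subseteq> N1" by (auto simp: N_def)
  have sub: "{-r<..<r} \<times> N \<subseteq> S" using box(1) r NN1 by auto
  have imp: "open N" "smooth_on g ({-r<..<r} \<times> N)"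
    "\<And>p. p \<in> {-r<..<r} \<times> N \<Longrightarrow> dir_deriv (1, 0) g p > 0"
    "\<And>z. z \<in> N \<Longrightarrow> \<psi> z \<in> {-r<..<r}" "\<And>z. z \<in> N \<Longrightarrow> g (\<psi> z, z) = 0"
  proof -
    fix p assume "p \<in> {-r<..<r} \<times> N"
    then show "dir_deriv (1, 0) g p > 0"
      using box(2)[of "fst p" "snd p"] r NN1 m(1) by (auto simp: h_def)
  qed (use N smooth_on_subset[OF sf(2) sub] \<psi> in auto)
  have s\<psi>: "smooth_on \<psi> N" by (rule implicit_function_smooth[OF imp])
  define \<phi> where "\<phi> = (\<lambda>z. \<psi> z + (- 1 / 2) * F (\<psi> z, z))"
  have s\<phi>: "smooth_on \<phi> N"
    unfolding smooth_on_def \<phi>_def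
  proof
    fix k
    show "Ck_on k (\<lambda>z. \<psi> z + (- 1 / 2) * F (\<psi> z, z)) N"
      using s\<psi> sf(4) sub \<psi> N unfolding smooth_on_def
      by (intro Ck_on_add Ck_on_mult Ck_on_const Ck_on_graph[where S = S]) auto
  qed
  \<comment> \<open>The case \<open>\<psi> z \<ge> 0\<close> below bounds
    \<open>(t - \<phi> z)\<^sup>2\<close> by \<open>(4 / m + M) * f (t, z)\<close>. The same
    constant serves the other case because \<open>c \<le> m / 2\<close>.\<close>
  define c where "c = 1 / (4 / m + M)"
  have c: "c > 0" using m M by (simp add: c_def add_pos_pos)
  have bound: "f (t, z) \<ge> c * min (t\<^sup>2) ((t - \<phi> z)\<^sup>2)" if t: "0 \<le> t" "t < r" and z: "z \<in> N" for t z
  proof -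
    have z1: "z \<in> N1" using z NN1 by blast
    have taylor: "f (t, z) \<ge> f (s, z) + g (s, z) * (t - s) + m / 2 * (t - s)\<^sup>2" if s: "-r < s" "s < r" for s
    proof -
      have "\<exists>x\<in>{-r..r}. f (t, z) = f (s, z) + g (s, z) * (t - s) + h (x, z) / 2 * (t - s)\<^sup>2"
        by (rule taylor_second_order[where h = "\<lambda>t. f (t, z)" and h' = "\<lambda>t. g (t, z)"])
          (use df z1 r t s in auto)
      then obtain x where x: "x \<in> {-r..r}"
        "f (t, z) = f (s, z) + g (s, z) * (t - s) + h (x, z) / 2 * (t - s)\<^sup>2" by blast
      have "m / 2 * (t - s)\<^sup>2 \<le> h (x, z) / 2 * (t - s)\<^sup>2"
        using box(2)[of x z] x(1) r z1 by (intro mult_right_mono) auto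
      with x(2) show ?thesis by simp
    qed
    show ?thesis
    proof (cases "\<psi> z \<ge> 0")
      case True
      \<comment> \<open>Taylor expansion at \<open>\<psi> z\<close> has no linear term, and
        Glaeser's inequality is available there because this time is nonnegative.\<close>
      have 1: "f (t, z) \<ge> f (\<psi> z, z) + m / 2 * (t - \<psi> z)\<^sup>2"
        using taylor[of "\<psi> z"] \<psi> z by simp
      have 2: "(F (\<psi> z, z))\<^sup>2 \<le> 2 * M * f (\<psi> z, z)"
        using e(2)[of "(\<psi> z, z)"] box(3)[of "\<psi> z" z] \<psi>[OF z] r z1 True by simp
      have 3: "f (\<psi> z, z) \<ge> 0" using nonneg[of "\<psi> z" z] box(1)[of "\<psi> z" z] \<psi>[OF z] r z1 True
        by (simp add: S_def)
      \<comment> \<open>The square of a sum is at most twice the sum of the squares, applied to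
        \<open>t - \<psi> z\<close> and \<open>F (\<psi> z, z) / 2\<close>.\<close>
      have "(t - \<phi> z)\<^sup>2 \<le> 2 * (t - \<psi> z)\<^sup>2 + (F (\<psi> z, z))\<^sup>2 / 2"
        using zero_le_power2[of "(t - \<psi> z) - F (\<psi> z, z) / 2"]
        by (simp add: \<phi>_def power2_eq_square algebra_simps)
      also have "\<dots> \<le> 4 / m * (f (t, z) - f (\<psi> z, z)) + M * f (\<psi> z, z)"
        using 1 2 m(1) by (intro add_mono) (auto simp: field_simps)
      also have "\<dots> \<le> 4 / m * f (t, z) + M * f (t, z)"
      proof (rule add_mono)
        show "4 / m * (f (t, z) - f (\<psi> z, z)) \<le> 4 / m * f (t, z)"
          using 3 m(1) by (intro mult_left_mono) auto
        have "0 \<le> m / 2 * (t - \<psi> z)\<^sup>2" using m(1) by simp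
        then show "M * f (\<psi> z, z) \<le> M * f (t, z)"
          using 1 M by (intro mult_left_mono) linarith+
      qed
      also have "\<dots> = f (t, z) / c" by (simp add: c_def algebra_simps)
      finally have "c * (t - \<phi> z)\<^sup>2 \<le> f (t, z)" using c by (simp add: field_simps)
      moreover have "c * min (t\<^sup>2) ((t - \<phi> z)\<^sup>2) \<le> c * (t - \<phi> z)\<^sup>2"
        using c by (intro mult_left_mono) auto
      ultimately show ?thesis by linarith
    next
      case False
      \<comment> \<open>For negative \<open>\<psi> z\<close> the time derivative is already
        nonnegative at time 0, so expansion at 0 bounds \<open>f\<close> below by a multiple of
        \<open>t\<^sup>2\<close>.\<close>
      have "g (0, z) \<ge> 0" using mono[of z "\<psi> z" 0] \<psi>[OF z] z1 r False by simp
      then have "g (0, z) * t \<ge> 0" using t by simp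
      moreover have "f (0, z) \<ge> 0" using nonneg[of 0 z] box(1)[of 0 z] r z1 by (simp add: S_def)
      ultimately have "m / 2 * t\<^sup>2 \<le> f (t, z)" using taylor[of 0] r by simp
      moreover have "c \<le> m / 2"
      proof -
        have "c \<le> 1 / (4 / m)" unfolding c_def using m(1) M by (intro frac_le) auto
        also have "\<dots> \<le> m / 2" using m(1) by simp
        finally show ?thesis .
      qed
      then have "c * min (t\<^sup>2) ((t - \<phi> z)\<^sup>2) \<le> m / 2 * t\<^sup>2"
        using c m(1) by (intro mult_mono) auto
      ultimately show ?thesis by linarith
    qed
  qed
  have \<psi>0: "\<psi> z0 = 0"
    using mono[of z0 "\<psi> z0" 0] mono[of z0 0 "\<psi> z0"] g0 \<psi>[OF z0] A(3) r
    by (cases "\<psi> z0" "0::real" rule: linorder_cases) auto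
  have deriv: "dir_deriv v \<phi> z0 = - B (1, 0) (0, v) z0 / B (1, 0) (1, 0) z0
       - (B (0, v) (0, w0) z0 - B (1, 0) (0, w0) z0 * B (1, 0) (0, v) z0 / B (1, 0) (1, 0) z0) / 2" for v
  proof -
    have sym: "B u v z0 = B v u z0" for u v
      unfolding B_def using dir_deriv_commute[OF S] sf(1) by (simp add: smooth_on_def)
    have d\<psi>: "dir_deriv v \<psi> z0 = - B (1, 0) (0, v) z0 / B (1, 0) (1, 0) z0"
      using dir_deriv_eq[OF implicit_function_has_derivative[OF imp z0]] sym[of "(1, 0)" "(0, v)"]
      by (simp add: \<psi>0 B_def g_def)
    have diff: "\<psi> differentiable (at z0)" "F differentiable (at (\<psi> z0, z0))"
      using smooth_on_imp_differentiable[OF s\<psi> z0] smooth_on_imp_differentiable[OF sf(4)] S(2) \<psi>0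
      by auto
    have diff2: "(\<lambda>z. F (\<psi> z, z)) differentiable (at z0)"
      using differentiable_chain_at[of "\<lambda>z. (\<psi> z, z)" z0 F] diff
      by (simp add: o_def differentiable_Pair)
    have "dir_deriv v \<phi> z0 = dir_deriv v \<psi> z0 + (- 1 / 2) * dir_deriv v (\<lambda>z. F (\<psi> z, z)) z0"
      unfolding \<phi>_def
      by (rule dir_deriv_eq) (intro has_derivative_add has_derivative_mult_right has_derivative_dir_deriv diff diff2)
    also have "dir_deriv v (\<lambda>z. F (\<psi> z, z)) z0 = dir_deriv v \<psi> z0 * B (1, 0) (0, w0) z0 + B (0, v) (0, w0) z0"
      using dir_deriv_graph[OF diff] by (simp add: \<psi>0 B_def F_def)
    finally show ?thesis unfolding d\<psi> by (simp add: algebra_simps diff_divide_distrib)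
  qed
  have "N \<subseteq> \<Omega>" using sub r \<psi> by (force simp: S_def)
  show ?thesis
    by (rule that[OF N z0 \<open>N \<subseteq> \<Omega>\<close> s\<phi> c r(1) _ bound deriv]) (use r \<open>q \<le> T\<close> in auto)
qed

section \<open>Hamilton map\<close>

lemma linear_phase_expansion:
  fixes L :: "(real^'d::finite) \<times> (real^'d) \<Rightarrow> real"
  assumes L: "linear L"
  shows "L w = (\<Sum>j\<in>UNIV. fst w $ j * L (dir_x j) + snd w $ j * L (dir_xi j))"
proof -
  interpret linear L by fact
  have "w = (\<Sum>j\<in>UNIV. fst w $ j *\<^sub>R dir_x j + snd w $ j *\<^sub>R dir_xi j)"
    using basis_expansion[of "fst w"] basis_expansion[of "snd w"]
    by (simp add: prod_eq_iff fst_sum snd_sum dir_x_def dir_xi_def scalar_mult_eq_scaleR)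
  then have "L w = L (\<Sum>j\<in>UNIV. fst w $ j *\<^sub>R dir_x j + snd w $ j *\<^sub>R dir_xi j)" by simp
  then show ?thesis by (simp add: sum add scale)
qed

lemma linear_cotangent_expansion:
  fixes L :: "'d::finite cotangent \<Rightarrow> real"
  assumes L: "linear L"
  shows "L (t, y, s, w) = (\<Sum>i\<in>UNIV. (case i of None \<Rightarrow> t | Some j \<Rightarrow> y $ j) * L (dir_X i))
    + (\<Sum>i\<in>UNIV. (case i of None \<Rightarrow> s | Some j \<Rightarrow> w $ j) * L (dir_Xi i))"
proof -
  interpret linear L by fact
  have "(t, y, s, w) = t *\<^sub>R dir_X None + (\<Sum>j\<in>UNIV. y $ j *\<^sub>R dir_X (Some j))
     + (s *\<^sub>R dir_Xi None + (\<Sum>j\<in>UNIV. w $ j *\<^sub>R dir_Xi (Some j)))"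
    using basis_expansion[of y] basis_expansion[of w]
    by (simp add: prod_eq_iff fst_sum snd_sum scalar_mult_eq_scaleR)
  then have "L (t, y, s, w) = L (t *\<^sub>R dir_X None + (\<Sum>j\<in>UNIV. y $ j *\<^sub>R dir_X (Some j))
     + (s *\<^sub>R dir_Xi None + (\<Sum>j\<in>UNIV. w $ j *\<^sub>R dir_Xi (Some j))))" by simp
  also have "\<dots> = t * L (dir_X None) + (\<Sum>j\<in>UNIV. y $ j * L (dir_X (Some j)))
     + (s * L (dir_Xi None) + (\<Sum>j\<in>UNIV. w $ j * L (dir_Xi (Some j))))"
    by (simp only: sum add scale real_scaleR_def)
  finally show ?thesis by (simp add: UNIV_option_conv sum.reindex)
qed

lemma matrix_vector_mult_sum_type:
  fixes A :: "real^('i::finite + 'j::finite)^'k::finite"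
  shows "(A *v v) $ r = (\<Sum>i\<in>UNIV. A $ r $ Inl i * v $ Inl i) + (\<Sum>j\<in>UNIV. A $ r $ Inr j * v $ Inr j)"
  unfolding matrix_vector_mult_def by (simp add: UNIV_Plus_UNIV[symmetric] sum.Plus del: UNIV_Plus_UNIV)

lemma dir_deriv_snd_slice:
  assumes "f differentiable (at (t, z))"
  shows "(\<lambda>z. f (t, z)) differentiable (at z)" "dir_deriv v (\<lambda>z. f (t, z)) z = dir_deriv (0, v) f (t, z)"
proof -
  have "((\<lambda>z. (t, z)) has_derivative (\<lambda>v. (0, v))) (at z)"
    by (auto intro!: derivative_eq_intros)
  from has_derivative_compose[OF this has_derivative_dir_deriv[OF assms]]
  show "(\<lambda>z. f (t, z)) differentiable (at z)" "dir_deriv v (\<lambda>z. f (t, z)) z = dir_deriv (0, v) f (t, z)"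
    by (auto simp: differentiable_def intro: dir_deriv_eq)
qed

text \<open>The sign is chosen so that \<open>n\<close> is the Hamilton vector of \<phi> when the
  differential of \<phi> is \<open>n \<bullet> symplectic_J v\<close>: then the bracket of \<phi>
  with a function is the derivative of that function along \<open>n\<close>.\<close>

definition symplectic_J :: "(real^'d::finite) \<times> (real^'d) \<Rightarrow> (real^'d) \<times> (real^'d)" where
  "symplectic_J w = (snd w, - fst w)"

lemma symplectic_form_J: "symplectic_form symplectic_J"
  by standard (auto simp: symplectic_J_def linear_iff inner_prod_def inner_commute)

context
  fixes a :: "real \<times> (real^'d::finite) \<times> (real^'d) \<Rightarrow> real" and p :: "'d cotangent \<Rightarrow> real"
    and S :: "(real \<times> (real^'d) \<times> (real^'d)) set"
  assumes S: "open S" and a: "smooth_on a S"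
    and p: "\<And>t x tau xi. p (t, x, tau, xi) = - tau\<^sup>2 + a (t, x, xi)"
begin

lemma dir_deriv_symbol:
  assumes "(t, x, xi) \<in> S"
  shows "dir_deriv (s, y, u, w) p (t, x, tau, xi) = - 2 * tau * u + dir_deriv (s, y, w) a (t, x, xi)"
proof -
  have da: "a differentiable (at (t, x, xi))" using smooth_on_imp_differentiable[OF a assms] .
  have "((\<lambda>q :: 'd cotangent. (fst q, fst (snd q), snd (snd (snd q)))) has_derivative
      (\<lambda>v. (fst v, fst (snd v), snd (snd (snd v))))) (at (t, x, tau, xi))"
    by (auto intro!: derivative_eq_intros)
  from has_derivative_compose[OF this] has_derivative_dir_deriv[OF da]
  have "((\<lambda>q. a (fst q, fst (snd q), snd (snd (snd q)))) has_derivative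
      (\<lambda>v. dir_deriv (fst v, fst (snd v), snd (snd (snd v))) a (t, x, xi))) (at (t, x, tau, xi))"
    by simp
  moreover have "((\<lambda>q :: 'd cotangent. - (fst (snd (snd q)))\<^sup>2) has_derivative
      (\<lambda>v. - 2 * tau * fst (snd (snd v)))) (at (t, x, tau, xi))"
    by (auto intro!: derivative_eq_intros)
  ultimately have "((\<lambda>q. - (fst (snd (snd q)))\<^sup>2 + a (fst q, fst (snd q), snd (snd (snd q)))) has_derivative
      (\<lambda>v. - 2 * tau * fst (snd (snd v)) + dir_deriv (fst v, fst (snd v), snd (snd (snd v))) a (t, x, xi)))
      (at (t, x, tau, xi))" by (intro has_derivative_add)
  moreover have "p = (\<lambda>q. - (fst (snd (snd q)))\<^sup>2 + a (fst q, fst (snd q), snd (snd (snd q))))"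
    using p by (auto simp: fun_eq_iff)
  ultimately have "(p has_derivative
      (\<lambda>v. - 2 * tau * fst (snd (snd v)) + dir_deriv (fst v, fst (snd v), snd (snd (snd v))) a (t, x, xi)))
      (at (t, x, tau, xi))" by (simp only:)
  from dir_deriv_eq[OF this] show ?thesis by simp
qed

lemma second_dir_deriv_symbol:
  assumes "(t, x, xi) \<in> S"
  shows "dir_deriv v (dir_deriv (s, y, u, w) p) (t, x, tau, xi) =
    - 2 * fst (snd (snd v)) * u
    + dir_deriv (fst v, fst (snd v), snd (snd (snd v))) (dir_deriv (s, y, w) a) (t, x, xi)"
    and "dir_deriv (s, y, u, w) p differentiable (at (t, x, tau, xi))"
proof -
  define \<pi> where "\<pi> = (\<lambda>q :: 'd cotangent. (fst q, fst (snd q), snd (snd (snd q))))"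
  have "continuous_on UNIV \<pi>" unfolding \<pi>_def by (intro continuous_intros)
  then have open': "open (\<pi> -` S)" using S by (simp add: open_vimage)
  have mem: "(t, x, tau, xi) \<in> \<pi> -` S" using assms by (simp add: \<pi>_def)
  have da: "dir_deriv (s, y, w) a differentiable (at (t, x, xi))"
    using smooth_on_imp_differentiable[OF smooth_on_dir_deriv[OF a] assms] .
  have "(\<pi> has_derivative \<pi>) (at (t, x, tau, xi))"
    unfolding \<pi>_def by (auto intro!: derivative_eq_intros)
  from has_derivative_compose[OF this] has_derivative_dir_deriv[OF da]
  have "((\<lambda>q. dir_deriv (s, y, w) a (\<pi> q)) has_derivative
      (\<lambda>v. dir_deriv (\<pi> v) (dir_deriv (s, y, w) a) (t, x, xi))) (at (t, x, tau, xi))"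
    by (simp add: \<pi>_def)
  moreover have "((\<lambda>q :: 'd cotangent. - 2 * fst (snd (snd q)) * u) has_derivative
      (\<lambda>v. - 2 * fst (snd (snd v)) * u)) (at (t, x, tau, xi))"
    by (auto intro!: derivative_eq_intros)
  ultimately have "((\<lambda>q. - 2 * fst (snd (snd q)) * u + dir_deriv (s, y, w) a (\<pi> q)) has_derivative
      (\<lambda>v. - 2 * fst (snd (snd v)) * u + dir_deriv (\<pi> v) (dir_deriv (s, y, w) a) (t, x, xi)))
      (at (t, x, tau, xi))" by (intro has_derivative_add)
  then have *: "(dir_deriv (s, y, u, w) p has_derivative
      (\<lambda>v. - 2 * fst (snd (snd v)) * u + dir_deriv (\<pi> v) (dir_deriv (s, y, w) a) (t, x, xi)))
      (at (t, x, tau, xi))"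
    by (rule has_derivative_transform_within_open[OF _ open' mem])
      (auto simp: \<pi>_def dir_deriv_symbol)
  then show "dir_deriv (s, y, u, w) p differentiable (at (t, x, tau, xi))"
    by (auto simp: differentiable_def)
  show "dir_deriv v (dir_deriv (s, y, u, w) p) (t, x, tau, xi) =
    - 2 * fst (snd (snd v)) * u
    + dir_deriv (fst v, fst (snd v), snd (snd (snd v))) (dir_deriv (s, y, w) a) (t, x, xi)"
    using dir_deriv_eq[OF *] by (simp add: \<pi>_def)
qed

text \<open>The square of \<open>tau\<close> has zero gradient at \<open>tau = 0\<close>, so the
  coordinate derivatives of \<open>p\<close> are those of \<open>a\<close>; linearity extends this
  to all directions.\<close>

lemma singular_point_dir_deriv_zero:
  assumes z: "(t, x, xi) \<in> S" and sing: "singular_point p (t, x, 0, xi)"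
  shows "a (t, x, xi) = 0" "dir_deriv v a (t, x, xi) = 0"
proof -
  show "a (t, x, xi) = 0" using sing by (simp add: singular_point_def p)
  obtain s w where v: "v = (s, w)" by (cases v)
  have lin: "linear (\<lambda>v. dir_deriv v a (t, x, xi))"
    by (rule linear_dir_deriv[OF smooth_on_imp_differentiable[OF a z]])
  have "dir_deriv (dir_X i) p (t, x, 0, xi) = 0" "dir_deriv (dir_Xi i) p (t, x, 0, xi) = 0" for i
    using sing by (auto simp: singular_point_def)
  note this(1)[of None] this(1)[of "Some j" for j] this(2)[of "Some j" for j]
  then have d: "dir_deriv (1, 0) a (t, x, xi) = 0" "dir_deriv (0, dir_x j) a (t, x, xi) = 0"
    "dir_deriv (0, dir_xi j) a (t, x, xi) = 0" for j
    using z by (simp_all add: dir_deriv_symbol dir_x_def dir_xi_def zero_prod_def)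
  have "linear (\<lambda>w. dir_deriv (0, w) a (t, x, xi))"
    using linear_compose[OF _ lin, of "\<lambda>w. (0, w)"] by (simp add: o_def linear_iff)
  from linear_phase_expansion[OF this, of w] have "dir_deriv (0, w) a (t, x, xi) = 0" by (simp add: d)
  with linear_split_fst[OF lin, of s w] show "dir_deriv v a (t, x, xi) = 0" by (simp add: v d)
qed

text \<open>Row \<open>Inl None\<close> gives \<open>\<tau> = - (l * s)\<close>, and row
  \<open>Inr None\<close> then produces the factor \<open>2 * l\<^sup>2\<close>. The other rows
  combine into the symplectic identity. If \<open>s\<close> and \<open>w\<close> vanished, so would
  \<tau> and the eigenvector.\<close>

lemma hamilton_eigenvector:
  fixes t :: real and z :: "(real^'d) \<times> (real^'d)"
  defines "B \<equiv> \<lambda>u v. dir_deriv u (dir_deriv v a) (t, z)"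
  assumes z: "(t, z) \<in> S" and ev: "real_eigenvalue (hamilton_map p (t, fst z, 0, snd z)) l" and l: "l \<noteq> 0"
  obtains s w where "s \<noteq> 0 \<or> w \<noteq> 0" "2 * l\<^sup>2 * s = B (1, 0) (s, w)"
    "\<And>v. 2 * l * (w \<bullet> symplectic_J v) = B (0, v) (s, w)"
proof -
  define H where "H = hamilton_map p (t, fst z, 0, snd z)"
  obtain e where e: "e \<noteq> 0" "H *v e = l *\<^sub>R e"
    using ev by (auto simp: real_eigenvalue_def H_def)
  define y where "y = (\<chi> j. e $ Inl (Some j))"
  define \<eta> where "\<eta> = (\<chi> j. e $ Inr (Some j))"
  define s where "s = e $ Inl None"
  define \<tau> where "\<tau> = e $ Inr None"
  have z': "(t, fst z, snd z) \<in> S" using z by simp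
  have opt: "(case i of None \<Rightarrow> s | Some j \<Rightarrow> y $ j) = e $ Inl i"
    "(case i of None \<Rightarrow> \<tau> | Some j \<Rightarrow> \<eta> $ j) = e $ Inr i" for i
    by (auto simp: s_def y_def \<tau>_def \<eta>_def split: option.split)
  have expand: "(\<Sum>i\<in>UNIV. dir_deriv (dir_X i) (dir_deriv v p) (t, fst z, 0, snd z) * e $ Inl i)
    + (\<Sum>i\<in>UNIV. dir_deriv (dir_Xi i) (dir_deriv v p) (t, fst z, 0, snd z) * e $ Inr i)
    = dir_deriv (s, y, \<tau>, \<eta>) (dir_deriv v p) (t, fst z, 0, snd z)" for v
  proof -
    obtain v1 v2 v3 v4 where v: "v = (v1, v2, v3, v4)" by (metis surj_pair)
    have "linear (\<lambda>u. dir_deriv u (dir_deriv v p) (t, fst z, 0, snd z))"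
      unfolding v by (rule linear_dir_deriv[OF second_dir_deriv_symbol(2)[OF z']])
    from linear_cotangent_expansion[OF this, of s y \<tau> \<eta>] show ?thesis
      unfolding opt by (simp add: mult.commute)
  qed
  have rowX: "dir_deriv (s, y, \<tau>, \<eta>) (dir_deriv (dir_Xi i) p) (t, fst z, 0, snd z) = 2 * l * e $ Inl i" for i
  proof -
    have "(H *v e) $ Inl i = l * e $ Inl i" by (simp add: e)
    then show ?thesis
      unfolding matrix_vector_mult_sum_type expand[symmetric]
      by (simp add: H_def hamilton_map_def sum_divide_distrib[symmetric] distrib_left[symmetric])
  qed
  have rowXi: "dir_deriv (s, y, \<tau>, \<eta>) (dir_deriv (dir_X i) p) (t, fst z, 0, snd z) = - (2 * l * e $ Inr i)" for i
  proof -
    have "(H *v e) $ Inr i = l * e $ Inr i" by (simp add: e)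
    then show ?thesis
      unfolding matrix_vector_mult_sum_type expand[symmetric]
      by (simp add: H_def hamilton_map_def sum_negf sum_divide_distrib[symmetric])
  qed
  have da: "dir_deriv v a differentiable (at (t, z))" for v
    using smooth_on_imp_differentiable[OF smooth_on_dir_deriv[OF a] z] .
  have sym: "B u v = B v u" for u v
    unfolding B_def using dir_deriv_commute[OF S z] a by (simp add: smooth_on_def)
  have symbol: "dir_deriv (s, y, \<tau>, \<eta>) (dir_deriv (s', y', \<tau>', \<eta>') p) (t, fst z, 0, snd z) =
    - 2 * \<tau> * \<tau>' + B (s', y', \<eta>') (s, y, \<eta>)" for s' y' \<tau>' \<eta>'
    using second_dir_deriv_symbol(1)[OF z', of "(s, y, \<tau>, \<eta>)"] sym[of "(s', y', \<eta>')"]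
    by (simp add: B_def)
  have "B (0, 0, 0) (s, y, \<eta>) = 0"
    unfolding B_def using linear_0[OF linear_dir_deriv[OF da]] by (simp add: zero_prod_def)
  then have \<tau>: "\<tau> = - (l * s)"
    using rowX[of None] by (simp add: symbol s_def[symmetric])
  have "B (1, 0) (s, y, \<eta>) = - (2 * l * \<tau>)"
    using rowXi[of None] by (simp add: symbol \<tau>_def[symmetric] zero_prod_def)
  then have 1: "2 * l\<^sup>2 * s = B (1, 0) (s, y, \<eta>)" by (simp add: \<tau> power2_eq_square)
  have 2: "2 * l * ((y, \<eta>) \<bullet> symplectic_J v) = B (0, v) (s, y, \<eta>)" for v
  proof -
    have coord: "e $ Inl (Some j) = y $ j" "e $ Inr (Some j) = \<eta> $ j" for j
      by (simp_all add: y_def \<eta>_def)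
    have x: "B (0, dir_x j) (s, y, \<eta>) = - (2 * l * \<eta> $ j)"
      "B (0, dir_xi j) (s, y, \<eta>) = 2 * l * y $ j" for j
      using rowXi[of "Some j"] rowX[of "Some j"]
      by (simp_all add: symbol dir_x_def dir_xi_def coord)
    have "linear (\<lambda>v. B (0, v) (s, y, \<eta>))"
      using linear_compose[OF _ linear_dir_deriv[OF da], of "\<lambda>w. (0, w)"]
      by (simp add: B_def o_def linear_iff)
    from linear_phase_expansion[OF this, of v]
    have "B (0, v) (s, y, \<eta>) = (\<Sum>j\<in>UNIV. 2 * l * (y $ j * snd v $ j - \<eta> $ j * fst v $ j))"
      by (simp add: x algebra_simps)
    also have "\<dots> = 2 * l * ((y, \<eta>) \<bullet> symplectic_J v)"
      by (simp add: symplectic_J_def inner_prod_def inner_vec_def sum_distrib_left[symmetric]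
          sum_subtractf sum_negf)
    finally show ?thesis by simp
  qed
  have "s \<noteq> 0 \<or> (y, \<eta>) \<noteq> 0"
  proof (rule ccontr)
    assume "\<not> (s \<noteq> 0 \<or> (y, \<eta>) \<noteq> 0)"
    then have "s = 0" "y = 0" "\<eta> = 0" "\<tau> = 0" by (auto simp: \<tau> zero_prod_def)
    then have "e $ Inl i = 0" "e $ Inr i = 0" for i
      using opt[of i] by (simp_all split: option.splits)
    then have "e $ r = 0" for r by (cases r) auto
    then show False using e by (simp add: vec_eq_iff)
  qed
  from that[OF this 1 2] show ?thesis .
qed

end

section \<open>Poisson brackets and homogeneity\<close>

text \<open>The filter form allows finitely many instances of the inequality to be combined on one
  neighbourhood.\<close>

lemma eventually_glaeser:
  fixes f :: "'a::real_normed_vector \<Rightarrow> real"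
  assumes "open S" "z0 \<in> S" "smooth_on f S" "dir_deriv w f z0 = 0"
    and "dir_deriv w (dir_deriv w f) z0 < M" "0 < M"
    and "\<And>z. z \<in> S \<inter> A \<Longrightarrow> f z \<ge> 0" "\<And>z s. z \<in> A \<Longrightarrow> z + s *\<^sub>R w \<in> A"
  shows "\<forall>\<^sub>F z in nhds z0. z \<in> A \<longrightarrow> (dir_deriv w f z)\<^sup>2 \<le> 2 * M * f z"
proof -
  have "Ck_on 2 f S" using assms(3) by (simp add: smooth_on_def)
  from glaeser_local[OF assms(1,2) this assms(4-8)] show ?thesis
    unfolding eventually_nhds_metric by (auto simp: dist_commute)
qed

lemma eventually_nhds_prod_box:
  fixes z0 :: "'a::metric_space"
  assumes "\<forall>\<^sub>F p in nhds (0::real, z0). P p"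
  obtains d where "d > 0" "\<And>t z. \<bar>t\<bar> < d \<Longrightarrow> dist z z0 < d \<Longrightarrow> P (t, z)"
proof -
  obtain e where e: "e > 0" "\<And>p. dist p (0, z0) < e \<Longrightarrow> P p"
    using assms unfolding eventually_nhds_metric by blast
  have "P (t, z)" if "\<bar>t\<bar> < e / 2" "dist z z0 < e / 2" for t z
  proof (rule e)
    have "dist (t, z) (0, z0) \<le> dist t 0 + dist z z0"
      unfolding dist_Pair_Pair by (rule sqrt_sum_squares_le_sum) auto
    then show "dist (t, z) (0, z0) < e" using that by simp
  qed
  then show ?thesis using e(1) by (intro that[of "e / 2"]) auto
qed

text \<open>With the gradient of \<phi> frozen at \<open>z0\<close>, the bracket is the derivative
  of \<open>a\<close> along \<open>n\<close>, and Glaeser's inequality holds with a constant below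
  2. The change of the gradient near \<open>z0\<close> multiplies coordinate derivatives of
  \<open>a\<close>, which Glaeser's inequality bounds by multiples of the root of
  \<open>a\<close>.\<close>

lemma poisson_bound:
  fixes a :: "real \<times> (real^'d::finite) \<times> (real^'d) \<Rightarrow> real"
    and \<phi> :: "(real^'d) \<times> (real^'d) \<Rightarrow> real"
  assumes S: "open S" "(0, z0) \<in> S" and a: "smooth_on a S"
    and nonneg: "\<And>t z. (t, z) \<in> S \<Longrightarrow> 0 \<le> t \<Longrightarrow> a (t, z) \<ge> 0"
    and crit: "\<And>v. dir_deriv v a (0, z0) = 0"
    and V: "open V" "z0 \<in> V" and \<phi>: "smooth_on \<phi> V"
    and d\<phi>: "\<And>v. dir_deriv v \<phi> z0 = n \<bullet> symplectic_J v"
    and n: "dir_deriv (0, n) (dir_deriv (0, n) a) (0, z0) < 2"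
  obtains \<kappa> where "0 < \<kappa>" "\<kappa> < 1"
    "\<forall>\<^sub>F p in nhds (0, z0). 0 \<le> fst p \<longrightarrow>
       (poisson \<phi> (\<lambda>z. a (fst p, z)) (snd p))\<^sup>2 \<le> 4 * \<kappa> * a p"
proof -
  define B where "B = (\<lambda>w. dir_deriv (0, w) (dir_deriv (0, w) a) (0, z0))"
  \<comment> \<open>The midpoint of \<open>max 1 (B n)\<close> and 2 is positive and strictly
    between \<open>B n\<close> and 2.\<close>
  define M where "M = (max 1 (B n) + 2) / 2"
  have M: "B n < M" "0 < M" "M < 2" using n by (auto simp: M_def B_def max_def)
  define C where "C = 1 + (\<Sum>j\<in>UNIV. \<bar>B (dir_x j)\<bar> + \<bar>B (dir_xi j)\<bar>)"
  have C: "C > 0" by (simp add: C_def add_pos_nonneg sum_nonneg)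
  have BC: "B (dir_x j) < C" "B (dir_xi j) < C" for j
  proof -
    have "\<bar>B (dir_x j)\<bar> + \<bar>B (dir_xi j)\<bar> \<le> (\<Sum>j\<in>UNIV. \<bar>B (dir_x j)\<bar> + \<bar>B (dir_xi j)\<bar>)"
      by (rule member_le_sum) auto
    then show "B (dir_x j) < C" "B (dir_xi j) < C" by (auto simp: C_def)
  qed
  have glaeser: "\<forall>\<^sub>F p in nhds (0, z0). 0 \<le> fst p \<longrightarrow> (dir_deriv (0, w) a p)\<^sup>2 \<le> 2 * K * a p"
    if "B w < K" "0 < K" for w K
    using eventually_glaeser[OF S a crit, of "(0, w)" K "{p. 0 \<le> fst p}"] that nonneg
    by (auto simp: B_def)
  \<comment> \<open>\<open>gap\<close> is the room between Glaeser's factor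
    \<open>sqrt (2 * M)\<close> and \<open>sqrt (M + 2)\<close>, positive because
    \<open>M < 2\<close>. The tolerance \<eta> shares it among the \<open>2 * CARD('d)\<close> error
    terms, leading to \<open>\<kappa> = (M + 2) / 4\<close>.\<close>
  define gap where "gap = sqrt (M + 2) - sqrt (2 * M)"
  have gap: "gap > 0" using M by (simp add: gap_def)
  define \<eta> where "\<eta> = gap / (2 * real CARD('d) * sqrt (2 * C))"
  have \<eta>: "\<eta> > 0" using gap C by (simp add: \<eta>_def)
  have near: "\<forall>\<^sub>F p in nhds (0::real, z0). \<bar>dir_deriv v \<phi> (snd p) - n \<bullet> symplectic_J v\<bar> < \<eta>" for v
  proof -
    have "continuous (at z0) (dir_deriv v \<phi>)"
      using smooth_on_imp_continuous_on[OF smooth_on_dir_deriv[OF \<phi>]] V continuous_on_eq_continuous_at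
      by blast
    then have "(dir_deriv v \<phi> \<longlongrightarrow> dir_deriv v \<phi> z0) (nhds z0)"
      by (simp add: continuous_at tendsto_at_iff_tendsto_nhds)
    moreover have "filterlim snd (nhds z0) (nhds (0::real, z0))"
      using tendsto_snd[OF filterlim_ident, of "(0::real, z0)"] by simp
    ultimately have "((\<lambda>p. dir_deriv v \<phi> (snd p)) \<longlongrightarrow> dir_deriv v \<phi> z0) (nhds (0::real, z0))"
      by (rule filterlim_compose)
    from tendstoD[OF this \<eta>] show ?thesis by (simp add: dist_real_def d\<phi>)
  qed
  have "\<forall>\<^sub>F p in nhds (0, z0). p \<in> S" using S by (rule eventually_nhds_in_open)
  moreover note glaeser[OF M(1,2)]
  moreover have "\<forall>\<^sub>F p in nhds (0, z0). \<forall>j. 0 \<le> fst p \<longrightarrow> (dir_deriv (0, dir_x j) a p)\<^sup>2 \<le> 2 * C * a p"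
    by (intro eventually_all_finite glaeser BC C)
  moreover have "\<forall>\<^sub>F p in nhds (0, z0). \<forall>j. 0 \<le> fst p \<longrightarrow> (dir_deriv (0, dir_xi j) a p)\<^sup>2 \<le> 2 * C * a p"
    by (intro eventually_all_finite glaeser BC C)
  moreover have "\<forall>\<^sub>F p in nhds (0::real, z0). \<forall>j. \<bar>dir_deriv (dir_x j) \<phi> (snd p) - n \<bullet> symplectic_J (dir_x j)\<bar> < \<eta>"
    by (intro eventually_all_finite near)
  moreover have "\<forall>\<^sub>F p in nhds (0::real, z0). \<forall>j. \<bar>dir_deriv (dir_xi j) \<phi> (snd p) - n \<bullet> symplectic_J (dir_xi j)\<bar> < \<eta>"
    by (intro eventually_all_finite near)
  ultimately have "\<forall>\<^sub>F p in nhds (0, z0). 0 \<le> fst p \<longrightarrow>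
       (poisson \<phi> (\<lambda>z. a (fst p, z)) (snd p))\<^sup>2 \<le> 4 * ((M + 2) / 4) * a p"
  proof (eventually_elim, intro impI)
    fix p assume p: "p \<in> S" and t: "0 \<le> fst p"
      and "0 \<le> fst p \<longrightarrow> (dir_deriv (0, n) a p)\<^sup>2 \<le> 2 * M * a p"
      and "\<forall>j. 0 \<le> fst p \<longrightarrow> (dir_deriv (0, dir_x j) a p)\<^sup>2 \<le> 2 * C * a p"
      and "\<forall>j. 0 \<le> fst p \<longrightarrow> (dir_deriv (0, dir_xi j) a p)\<^sup>2 \<le> 2 * C * a p"
      and x: "\<forall>j. \<bar>dir_deriv (dir_x j) \<phi> (snd p) - n \<bullet> symplectic_J (dir_x j)\<bar> < \<eta>"
      and xi: "\<forall>j. \<bar>dir_deriv (dir_xi j) \<phi> (snd p) - n \<bullet> symplectic_J (dir_xi j)\<bar> < \<eta>"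
    define r where "r = sqrt (a p)"
    have ap: "a p \<ge> 0" using nonneg[of "fst p" "snd p"] p t by simp
    then have r: "r \<ge> 0" "r\<^sup>2 = a p" by (auto simp: r_def)
    have root: "\<bar>y\<bar> \<le> sqrt (2 * K) * r" if "y\<^sup>2 \<le> 2 * K * a p" for y K
      using real_sqrt_le_mono[OF that] by (simp add: r_def real_sqrt_mult)
    define q where "q = (\<lambda>j. dir_deriv (dir_xi j) \<phi> (snd p) - n \<bullet> symplectic_J (dir_xi j))"
    define q' where "q' = (\<lambda>j. dir_deriv (dir_x j) \<phi> (snd p) - n \<bullet> symplectic_J (dir_x j))"
    define b where "b = (\<lambda>j. dir_deriv (0, dir_x j) a p)"
    define b' where "b' = (\<lambda>j. dir_deriv (0, dir_xi j) a p)"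
    have bounds: "\<bar>dir_deriv (0, n) a p\<bar> \<le> sqrt (2 * M) * r" "\<bar>b j\<bar> \<le> sqrt (2 * C) * r"
      "\<bar>b' j\<bar> \<le> sqrt (2 * C) * r" "\<bar>q j\<bar> \<le> \<eta>" "\<bar>q' j\<bar> \<le> \<eta>" for j
      unfolding b_def b'_def q_def q'_def
      by (intro root; use t \<open>_ \<longrightarrow> (dir_deriv (0, n) a p)\<^sup>2 \<le> 2 * M * a p\<close>
          \<open>\<forall>j. 0 \<le> fst p \<longrightarrow> (dir_deriv (0, dir_x j) a p)\<^sup>2 \<le> 2 * C * a p\<close>
          \<open>\<forall>j. 0 \<le> fst p \<longrightarrow> (dir_deriv (0, dir_xi j) a p)\<^sup>2 \<le> 2 * C * a p\<close> in blast)+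
        (use x xi less_imp_le in blast)+
    have da: "a differentiable (at (fst p, snd p))" using smooth_on_imp_differentiable[OF a p] by simp
    have "linear (\<lambda>w. dir_deriv (0, w) a p)"
      using linear_compose[OF _ linear_dir_deriv[OF da], of "\<lambda>w. (0, w)"] by (simp add: o_def linear_iff)
    from linear_phase_expansion[OF this, of n]
    have "poisson \<phi> (\<lambda>z. a (fst p, z)) (snd p) = dir_deriv (0, n) a p + (\<Sum>j\<in>UNIV. q j * b j - q' j * b' j)"
      using da by (simp add: poisson_def dir_deriv_snd_slice q_def q'_def b_def b'_def symplectic_J_def
          dir_x_def dir_xi_def inner_prod_def inner_axis sum.distrib[symmetric] algebra_simps)
    also have "\<bar>\<dots>\<bar> \<le> sqrt (2 * M) * r + (\<Sum>j\<in>(UNIV::'d set). 2 * (\<eta> * (sqrt (2 * C) * r)))"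
    proof -
      have "\<bar>q j * b j - q' j * b' j\<bar> \<le> 2 * (\<eta> * (sqrt (2 * C) * r))" for j
      proof -
        have "\<bar>q j * b j - q' j * b' j\<bar> \<le> \<bar>q j\<bar> * \<bar>b j\<bar> + \<bar>q' j\<bar> * \<bar>b' j\<bar>"
          using abs_triangle_ineq4[of "q j * b j" "q' j * b' j"] by (simp add: abs_mult)
        also have "\<dots> \<le> \<eta> * (sqrt (2 * C) * r) + \<eta> * (sqrt (2 * C) * r)"
          using \<eta> by (intro add_mono mult_mono bounds) auto
        finally show ?thesis by linarith
      qed
      then have "\<bar>\<Sum>j\<in>UNIV. q j * b j - q' j * b' j\<bar> \<le> (\<Sum>j\<in>(UNIV::'d set). 2 * (\<eta> * (sqrt (2 * C) * r)))"
        by (intro order_trans[OF sum_abs sum_mono])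
      with bounds(1) show ?thesis by linarith
    qed
    also have "\<dots> = sqrt (M + 2) * r"
      using C by (simp add: \<eta>_def gap_def field_simps)
    finally have "(poisson \<phi> (\<lambda>z. a (fst p, z)) (snd p))\<^sup>2 \<le> (sqrt (M + 2) * r)\<^sup>2"
      by (simp add: abs_le_square_iff[symmetric])
    also have "\<dots> = (M + 2) * a p" using M by (simp add: power_mult_distrib r)
    also have "\<dots> = 4 * ((M + 2) / 4) * a p" by (simp add: field_simps)
    finally show "(poisson \<phi> (\<lambda>z. a (fst p, z)) (snd p))\<^sup>2 \<le> 4 * ((M + 2) / 4) * a p" .
  qed
  with M show ?thesis by (intro that[of "(M + 2) / 4"]) auto
qed

section \<open>Homogeneity under dilations of the fibre variable\<close>

definition xi_scale :: "real \<Rightarrow> (real^'d) \<times> (real^'d) \<Rightarrow> (real^'d) \<times> (real^'d)" where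
  "xi_scale l z = (fst z, l *\<^sub>R snd z)"

lemma bounded_linear_xi_scale: "bounded_linear (xi_scale l)"
  unfolding xi_scale_def
  by (intro bounded_linear_Pair bounded_linear_fst bounded_linear_scaleR_right[THEN bounded_linear_compose]
      bounded_linear_snd)

lemma xi_scale_dir [simp]: "xi_scale l (dir_x j) = dir_x j" "xi_scale l (dir_xi j) = l *\<^sub>R dir_xi j"
  by (auto simp: xi_scale_def dir_x_def dir_xi_def)

text \<open>The degree is an integer because derivatives in \<open>xi\<close> lower it below
  zero.\<close>

definition xi_homogeneous :: "((real^'d) \<times> (real^'d)) set \<Rightarrow> int \<Rightarrow> ((real^'d) \<times> (real^'d) \<Rightarrow> real) \<Rightarrow> bool" where
  "xi_homogeneous V k f \<longleftrightarrow> (\<forall>z\<in>V. \<forall>l>0. f (xi_scale l z) = l powi k * f z)"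

lemma conic_xi_scale: "conic_in_xi V \<Longrightarrow> z \<in> V \<Longrightarrow> l > 0 \<Longrightarrow> xi_scale l z \<in> V"
  by (cases z) (auto simp: conic_in_xi_def xi_scale_def)

context
  fixes V :: "((real^'d::finite) \<times> (real^'d)) set"
  assumes V: "open V" "conic_in_xi V"
begin

lemma xi_homogeneous_dir_deriv:
  assumes f: "xi_homogeneous V k f" "\<And>z. z \<in> V \<Longrightarrow> f differentiable (at z)"
  shows "xi_homogeneous V k (dir_deriv (dir_x j) f)" "xi_homogeneous V (k - 1) (dir_deriv (dir_xi j) f)"
proof -
  have *: "dir_deriv (xi_scale l v) f (xi_scale l z) = l powi k * dir_deriv v f z" if "z \<in> V" "l > 0" for l z v
    using that f conic_xi_scale[OF V(2)]
    by (intro dir_deriv_scale[OF V(1) _ bounded_linear_xi_scale]) (auto simp: xi_homogeneous_def)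
  show "xi_homogeneous V k (dir_deriv (dir_x j) f)"
    using *[where v = "dir_x j"] by (simp add: xi_homogeneous_def)
  have "dir_deriv (dir_xi j) f (xi_scale l z) = l powi (k - 1) * dir_deriv (dir_xi j) f z"
    if "z \<in> V" "l > 0" for l z
  proof -
    have "l * dir_deriv (dir_xi j) f (xi_scale l z) = l powi k * dir_deriv (dir_xi j) f z"
      using *[OF that, of "dir_xi j"] linear_scale[OF linear_dir_deriv, of f "xi_scale l z" l "dir_xi j"]
        f(2) conic_xi_scale[OF V(2)] that by simp
    then show ?thesis using that by (simp add: power_int_diff field_simps)
  qed
  then show "xi_homogeneous V (k - 1) (dir_deriv (dir_xi j) f)"
    by (simp add: xi_homogeneous_def)
qed

text \<open>One induction serves both families of derivatives: \<open>c\<close> is the loss of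
  degree per derivative, 0 for \<open>dir_x\<close> and 1 for \<open>dir_xi\<close>. Smoothness is
  carried along to supply differentiability at every stage.\<close>

lemma multi_deriv_homogeneous:
  assumes "xi_homogeneous V k f" "smooth_on f V"
  shows "xi_homogeneous V k (multi_deriv dir_x al f)" "smooth_on (multi_deriv dir_x al f) V"
    and "xi_homogeneous V (k - int (\<Sum>j\<in>UNIV. al j)) (multi_deriv dir_xi al f)"
    and "smooth_on (multi_deriv dir_xi al f) V"
proof -
  have pow: "xi_homogeneous V (k - int m * c) ((dir_deriv v ^^ m) f) \<and> smooth_on ((dir_deriv v ^^ m) f) V"
    if "\<And>k f. xi_homogeneous V k f \<Longrightarrow> smooth_on f V \<Longrightarrow> xi_homogeneous V (k - c) (dir_deriv v f)"
      and "xi_homogeneous V k f" "smooth_on f V" for m c k f v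
  proof (induction m)
    case (Suc m)
    then show ?case
      using that(1)[of "k - int m * c" "(dir_deriv v ^^ m) f"]
      by (simp add: smooth_on_dir_deriv algebra_simps)
  qed (use that in simp)
  have fold: "xi_homogeneous V (k - int (\<Sum>j\<leftarrow>js. al j) * c) (fold (\<lambda>j. dir_deriv (e j) ^^ al j) js f) \<and>
      smooth_on (fold (\<lambda>j. dir_deriv (e j) ^^ al j) js f) V"
    if "\<And>k f j. xi_homogeneous V k f \<Longrightarrow> smooth_on f V \<Longrightarrow> xi_homogeneous V (k - c) (dir_deriv (e j) f)"
      and "xi_homogeneous V k f" "smooth_on f V" for js c k f e
    using that(2,3)
  proof (induction js arbitrary: k f)
    case (Cons i js)
    have "xi_homogeneous V (k - int (al i) * c) ((dir_deriv (e i) ^^ al i) f) \<and>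
      smooth_on ((dir_deriv (e i) ^^ al i) f) V"
      by (rule pow[OF that(1) Cons.prems])
    with Cons.IH[of "k - int (al i) * c" "(dir_deriv (e i) ^^ al i) f"]
    show ?case by (simp add: algebra_simps)
  qed simp
  define js where "js = (SOME js. distinct js \<and> set js = (UNIV :: 'd set))"
  have "distinct js \<and> set js = (UNIV :: 'd set)"
    unfolding js_def using finite_distinct_list[OF finite_class.finite_UNIV] by (metis (mono_tags, lifting) someI_ex)
  then have sum: "(\<Sum>j\<leftarrow>js. al j) = (\<Sum>j\<in>UNIV. al j)"
    using sum_list_distinct_conv_sum_set[of js al] by simp
  have hx: "xi_homogeneous V (k - 0) (dir_deriv (dir_x j) f)"
    and hxi: "xi_homogeneous V (k - 1) (dir_deriv (dir_xi j) f)"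
    if "xi_homogeneous V k f" "smooth_on f V" for k f j
    using xi_homogeneous_dir_deriv[OF that(1)] smooth_on_imp_differentiable[OF that(2)] by auto
  show "xi_homogeneous V k (multi_deriv dir_x al f)" "smooth_on (multi_deriv dir_x al f) V"
    using fold[OF hx assms, of js] by (auto simp: multi_deriv_def js_def)
  show "xi_homogeneous V (k - int (\<Sum>j\<in>UNIV. al j)) (multi_deriv dir_xi al f)"
    "smooth_on (multi_deriv dir_xi al f) V"
    using fold[OF hxi assms, of js, unfolded sum] by (auto simp: multi_deriv_def js_def)
qed

text \<open>Every term of the bracket contains exactly one derivative in \<open>xi\<close>, whence
  the loss of one degree.\<close>

lemma poisson_homogeneous:
  assumes f: "xi_homogeneous V k f" "\<And>z. z \<in> V \<Longrightarrow> f differentiable (at z)"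
    and g: "xi_homogeneous V m g" "\<And>z. z \<in> V \<Longrightarrow> g differentiable (at z)"
  shows "xi_homogeneous V (k + m - 1) (poisson f g)"
  unfolding xi_homogeneous_def
proof (intro ballI allI impI)
  fix z l assume z: "z \<in> V" and l: "l > (0::real)"
  have p: "l powi (k + m - 1) = l powi (k - 1) * l powi m" "l powi (k + m - 1) = l powi k * l powi (m - 1)"
    using l by (simp_all add: power_int_add[symmetric] algebra_simps)
  have "poisson f g (xi_scale l z) = (\<Sum>j\<in>UNIV.
      (l powi (k - 1) * l powi m) * (dir_deriv (dir_xi j) f z * dir_deriv (dir_x j) g z)
      - (l powi k * l powi (m - 1)) * (dir_deriv (dir_x j) f z * dir_deriv (dir_xi j) g z))"
    using xi_homogeneous_dir_deriv[OF f] xi_homogeneous_dir_deriv[OF g] z l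
    unfolding xi_homogeneous_def poisson_def by (intro sum.cong) (auto simp: mult_ac)
  also have "\<dots> = l powi (k + m - 1) * poisson f g z"
    unfolding p[symmetric] poisson_def sum_distrib_left by (simp add: right_diff_distrib)
  finally show "poisson f g (xi_scale l z) = l powi (k + m - 1) * poisson f g z" .
qed

end

lemma jap_le: "norm xi \<ge> 1 \<Longrightarrow> jap xi \<le> 2 * norm xi"
proof -
  assume *: "norm xi \<ge> 1"
  have "1 + (norm xi)\<^sup>2 \<le> (2 * norm xi)\<^sup>2"
    using one_le_power[OF *, of 2] by (simp add: power_mult_distrib)
  then show ?thesis unfolding jap_def using * by (intro real_le_lsqrt) auto
qed

theorem proposition1p1:
  fixes a :: "real \<times> (real^'d::finite) \<times> (real^'d) \<Rightarrow> real"
    and p :: "real \<times> (real^'d) \<times> real \<times> (real^'d) \<Rightarrow> real"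
    and U :: "(real^'d) set"
    and T T1 :: real
    and xib :: "real^'d"
  assumes "T > 0" and "open U" and "0 \<in> U"
    and "smooth_on a ({-T<..<T} \<times> U \<times> (UNIV - {0}))"
    and "\<And>t x xi l. t \<in> {-T<..<T} \<Longrightarrow> x \<in> U \<Longrightarrow> xi \<noteq> 0 \<Longrightarrow> l > 0 \<Longrightarrow>
           a (t, x, l *\<^sub>R xi) = l\<^sup>2 * a (t, x, xi)"
    and "\<And>t x tau xi. p (t, x, tau, xi) = - tau\<^sup>2 + a (t, x, xi)"
    and "T1 > 0"
    and "\<And>t x xi. t \<in> {0..<T1} \<Longrightarrow> x \<in> U \<Longrightarrow> xi \<noteq> 0 \<Longrightarrow> a (t, x, xi) \<ge> 0"
    and "xib \<noteq> 0"
    and "singular_point p (0, 0, 0, xib)"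
    and "effectively_hyperbolic p (0, 0, 0, xib)"
  shows "\<exists>(V :: ((real^'d) \<times> (real^'d)) set) (\<phi> :: (real^'d) \<times> (real^'d) \<Rightarrow> real) \<kappa> c \<delta>.
     open V \<and> (0, xib) \<in> V \<and> conic_in_xi V \<and> V \<subseteq> U \<times> (UNIV - {0}) \<and>
     smooth_on \<phi> V \<and>
     (\<forall>x xi. \<forall>l>0. (x, xi) \<in> V \<longrightarrow> \<phi> (x, l *\<^sub>R xi) = \<phi> (x, xi)) \<and>
     0 < \<kappa> \<and> \<kappa> < 1 \<and> 0 < c \<and> 0 < \<delta> \<and> \<delta> \<le> T \<and>
     (\<forall>t x xi. t \<in> {0..<\<delta>} \<longrightarrow> (x, xi) \<in> V \<longrightarrow>
        a (t, x, xi) \<ge> c * min (t\<^sup>2) ((t - \<phi> (x, xi))\<^sup>2) * (norm xi)\<^sup>2 \<and>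
        (poisson \<phi> (\<lambda>z. a (t, z)) (x, xi))\<^sup>2 \<le> 4 * \<kappa> * a (t, x, xi)) \<and>
     (\<forall>\<alpha> \<beta> :: 'd \<Rightarrow> nat. \<exists>C. \<forall>x xi. (x, xi) \<in> V \<longrightarrow> norm xi \<ge> 1 \<longrightarrow>
        \<bar>multi_deriv dir_x \<alpha> (multi_deriv dir_xi \<beta> \<phi>) (x, xi)\<bar>
          \<le> C * jap xi powi (- int (\<Sum>j\<in>UNIV. \<beta> j)))"
proof -
  note T = assms(1) and U = assms(2,3) and a0 = assms(4) and hom = assms(5) and p = assms(6)
    and T1 = assms(7) and nonneg = assms(8) and xib = assms(9) and sing = assms(10) and hyp = assms(11)
  define \<Omega> where "\<Omega> = U \<times> (UNIV - {0} :: (real^'d) set)"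
  define T' where "T' = min T T1"
  define S where "S = {-T'<..<T'} \<times> \<Omega>"
  define z0 where "z0 = (0 :: real^'d, xib)"
  have T': "T' > 0" "T' \<le> T" "T' \<le> T1" using T T1 by (auto simp: T'_def)
  have \<Omega>: "open \<Omega>" "z0 \<in> \<Omega>" using U xib by (auto simp: \<Omega>_def z0_def intro!: open_Times)
  have S: "open S" "(0, z0) \<in> S" using \<Omega> T' by (auto simp: S_def open_Times)
  have sa: "smooth_on a S"
    using T' by (intro smooth_on_subset[OF a0]) (auto simp: S_def \<Omega>_def)
  have ahom: "a (t, xi_scale l z) = l\<^sup>2 * a (t, z)" if "(t, z) \<in> S" "l > 0" for t z l
    using hom[of t "fst z" "snd z" l] that T'
    by (simp add: S_def \<Omega>_def xi_scale_def mem_Times_iff)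
  have apos: "a (t, z) \<ge> 0" if "0 \<le> t" "t < T'" "z \<in> \<Omega>" for t z
    using nonneg[of t "fst z" "snd z"] that T' by (simp add: \<Omega>_def mem_Times_iff)
  have da: "a differentiable (at q)" "dir_deriv v a differentiable (at q)" if "q \<in> S" for q v
    using smooth_on_imp_differentiable[OF sa that]
      smooth_on_imp_differentiable[OF smooth_on_dir_deriv[OF sa] that] by auto
  have z0S: "(0, 0, xib) \<in> S" using S(2) by (simp add: z0_def)
  have crit: "a (0, z0) = 0" "dir_deriv v a (0, z0) = 0" for v
    using singular_point_dir_deriv_zero[OF S(1) sa p z0S sing] by (auto simp: z0_def)

  \<comment> \<open>The Hessian at the singular point\<close>
  define B where "B = (\<lambda>u v. dir_deriv u (dir_deriv v a) (0, z0))"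
  have sym: "B u v = B v u" for u v
    unfolding B_def using dir_deriv_commute[OF S] sa by (simp add: smooth_on_def)
  have lin: "linear (\<lambda>u. B u v)" for v
    unfolding B_def by (rule linear_dir_deriv[OF da(2)[OF S(2)]])
  have bil: "bilinear B"
    unfolding bilinear_def
  proof (intro conjI allI)
    show "linear (\<lambda>v. B u v)" for u
    proof -
      have "(\<lambda>v. B u v) = (\<lambda>v. B v u)" by (intro ext sym)
      then show ?thesis using lin[of u] by simp
    qed
  qed (rule lin)
  have psd: "B u u \<ge> 0" for u
  proof -
    \<comment> \<open>The sign of \<open>a\<close> is known for nonnegative times only, so the
      second derivative test covers the directions with \<open>fst u \<ge> 0\<close>; evenness of
      \<open>B u u\<close> covers the others.\<close>
    have half: "B u u \<ge> 0" if u: "fst u \<ge> 0" for u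
    proof -
      obtain e where e: "e > 0" "ball (0, z0) e \<subseteq> S" using S open_contains_ball by blast
      have n: "norm u + 1 > 0" by (simp add: add_nonneg_pos)
      have min: "a (0, z0) \<le> a ((0, z0) + s *\<^sub>R u)" if s: "0 < s" "s < e / (norm u + 1)" for s
      proof -
        have "s * norm u \<le> s * (norm u + 1)" using s by simp
        also have "\<dots> < e" using s n by (simp add: pos_less_divide_eq)
        finally have "(0, z0) + s *\<^sub>R u \<in> S" using e s by (auto simp: dist_norm)
        then show ?thesis
          using apos[of "s * fst u" "z0 + s *\<^sub>R snd u"] s u crit(1)
          by (cases u) (auto simp: S_def)
      qed
      have "e / (norm u + 1) > 0" "Ck_on 2 a S" using e n sa by (auto simp: smooth_on_def)
      with second_dir_deriv_nonneg[OF S _ crit(2) _ min] show ?thesis by (simp add: B_def)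
    qed
    have "B (- u) (- u) = B u u"
      using bilinear_lneg[OF bil] bilinear_rneg[OF bil] by simp
    then show ?thesis using half[of u] half[of "- u"] by (cases "fst u \<ge> 0") auto
  qed

  \<comment> \<open>The phase near the base point\<close>
  obtain l0 where l0: "l0 \<noteq> 0" "real_eigenvalue (hamilton_map p (0, fst z0, 0, snd z0)) l0"
    using hyp by (auto simp: effectively_hyperbolic_def z0_def)
  obtain s w where sw: "s \<noteq> 0 \<or> w \<noteq> 0" "2 * l0\<^sup>2 * s = B (1, 0) (s, w)"
    "\<And>v. 2 * l0 * (w \<bullet> symplectic_J v) = B (0, v) (s, w)"
    unfolding B_def by (rule hamilton_eigenvector[OF S(1) sa p S(2) l0(2,1)]) blast
  interpret symplectic_form "symplectic_J :: (real^'d) \<times> (real^'d) \<Rightarrow> _" by (rule symplectic_form_J)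
  obtain n w0 where \<alpha>: "B (1, 0) (1, 0) > 0" and Bn: "B (0, n) (0, n) < 2"
    and n: "\<And>w. n \<bullet> symplectic_J w = - B (1, 0) (0, w) / B (1, 0) (1, 0)
        - (B (0, w) (0, w0) - B (1, 0) (0, w0) * B (1, 0) (0, w) / B (1, 0) (1, 0)) / 2"
    by (rule effectively_hyperbolic_reduction[OF bil sym psd l0(1) sw]) blast
  obtain N \<phi>0 c r where N: "open N" "z0 \<in> N" "N \<subseteq> \<Omega>" and \<phi>0: "smooth_on \<phi>0 N"
    and cr: "c > 0" "0 < r" "r < T'"
    and lower: "\<And>t z. 0 \<le> t \<Longrightarrow> t < r \<Longrightarrow> z \<in> N \<Longrightarrow> a (t, z) \<ge> c * min (t\<^sup>2) ((t - \<phi>0 z)\<^sup>2)"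
    and d\<phi>0: "\<And>v. dir_deriv v \<phi>0 z0 = n \<bullet> symplectic_J v"
    unfolding n B_def
    by (rule local_lower_bound[OF T'(1) \<Omega> sa[unfolded S_def] apos crit(2) \<alpha>[unfolded B_def]]) blast+

  text \<open>The phase is extended homogeneously from the hyperplane through \<open>xib\<close> orthogonal to \<open>xib\<close>.\<close>
  define k where "k = xib \<bullet> xib"
  have k: "k > 0" using xib by (simp add: k_def)
  define H where "H = {z :: (real^'d) \<times> (real^'d). snd z \<bullet> xib > 0}"
  define prj where "prj = (\<lambda>z :: (real^'d) \<times> (real^'d). (fst z, (k / (snd z \<bullet> xib)) *\<^sub>R snd z))"
  have H: "open H" unfolding H_def by (intro open_Collect_less continuous_intros)
  have prj_cont: "continuous_on H prj"
    unfolding prj_def by (intro continuous_intros) (auto simp: H_def)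
  have prj_z0: "prj z0 = z0" "z0 \<in> H" using k by (auto simp: prj_def z0_def k_def H_def)
  have prj_scale: "prj (xi_scale l z) = prj z" "xi_scale l z \<in> H" if "z \<in> H" "l > 0" for l z
    using that by (auto simp: prj_def H_def xi_scale_def)
  have unprj: "z = xi_scale (snd z \<bullet> xib / k) (prj z)" if "z \<in> H" for z
    using that k by (auto simp: prj_def H_def xi_scale_def prod_eq_iff)
  have preimage: "open {z \<in> H. prj z \<in> M}" "conic_in_xi {z \<in> H. prj z \<in> M}" if "open M" for M
  proof -
    have "{z \<in> H. prj z \<in> M} = H \<inter> prj -` M" by auto
    then show "open {z \<in> H. prj z \<in> M}" using continuous_open_preimage[OF prj_cont H that] by simp
    show "conic_in_xi {z \<in> H. prj z \<in> M}"
      using prj_scale unfolding conic_in_xi_def xi_scale_def by fastforce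
  qed
  define V1 where "V1 = {z \<in> H. prj z \<in> N}"
  define \<phi> where "\<phi> = (\<lambda>z. \<phi>0 (prj z))"
  have V1: "open V1" "conic_in_xi V1" "z0 \<in> V1"
    using preimage[OF N(1)] prj_z0 N(2) by (auto simp: V1_def)
  have V1\<Omega>: "V1 \<subseteq> \<Omega>"
  proof
    fix z assume z: "z \<in> V1"
    then have "snd z \<noteq> 0" by (auto simp: V1_def H_def)
    moreover have "fst z \<in> U" using z N(3) by (auto simp: V1_def prj_def \<Omega>_def)
    ultimately show "z \<in> \<Omega>" by (cases z) (auto simp: \<Omega>_def)
  qed
  have \<phi>: "smooth_on \<phi> V1"
    unfolding smooth_on_def \<phi>_def
  proof
    fix m
    show "Ck_on m (\<lambda>z. \<phi>0 (prj z)) V1"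
    proof (rule Ck_on_compose[where f = \<phi>0 and g = prj and S = N, OF V1(1)])
      show "prj ` V1 \<subseteq> N" by (auto simp: V1_def)
      show "Ck_on m \<phi>0 N" using \<phi>0 by (simp add: smooth_on_def)
      fix b :: "(real^'d) \<times> (real^'d)"
      have "Ck_on m (\<lambda>z. fst z \<bullet> fst b + k * inverse (snd z \<bullet> xib) * (snd z \<bullet> snd b)) V1"
        using V1(1) by (intro Ck_on_add Ck_on_mult Ck_on_inverse Ck_on_const Ck_on_linear
            bounded_linear_inner_left_comp bounded_linear_fst bounded_linear_snd) (auto simp: V1_def H_def)
      then show "Ck_on m (\<lambda>z. prj z \<bullet> b) V1" by (simp add: prj_def inner_prod_def divide_inverse)
    qed
  qed
  have \<phi>hom: "xi_homogeneous V1 0 \<phi>"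
    using prj_scale by (auto simp: xi_homogeneous_def \<phi>_def V1_def)

  \<comment> \<open>Radial directions and the homogeneous extension\<close>
  have ray: "dir_deriv u a (0, xi_scale l z0) = 0" if "l > 0" for l u
  proof -
    have L: "bounded_linear (\<lambda>q :: real \<times> (real^'d) \<times> (real^'d). (fst q, xi_scale l (snd q)))"
      by (intro bounded_linear_Pair bounded_linear_fst bounded_linear_compose[OF bounded_linear_xi_scale]
          bounded_linear_snd)
    have "xi_scale l z0 \<in> \<Omega>" using \<Omega> that by (auto simp: \<Omega>_def z0_def xi_scale_def)
    then have "dir_deriv (fst v, xi_scale l (snd v)) a (0, xi_scale l z0) = l\<^sup>2 * dir_deriv v a (0, z0)" for v
      using dir_deriv_scale[OF S L, of a "l\<^sup>2" v] ahom that da(1) S(2) T' by (auto simp: S_def)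
    from this[of "(fst u, xi_scale (1 / l) (snd u))"] show ?thesis
      using that by (simp add: xi_scale_def crit(2))
  qed
  \<comment> \<open>By homogeneity the gradient of \<open>a\<close> vanishes along the whole ray
    through \<open>xib\<close>, so its derivative along the ray, the Hessian paired with the radial
    vector, is zero.\<close>
  have radial: "B (0, 0, xib) u = 0" for u
  proof -
    have "((\<lambda>s. dir_deriv u a ((0, z0) + s *\<^sub>R (0, 0, xib))) has_real_derivative
        dir_deriv (0, 0, xib) (dir_deriv u a) ((0, z0) + 0 *\<^sub>R (0, 0, xib))) (at 0)"
      by (rule has_real_derivative_dir_deriv) (use da(2)[OF S(2)] in \<open>simp add: zero_prod_def[symmetric]\<close>)
    then have "((\<lambda>s. dir_deriv u a ((0, z0) + s *\<^sub>R (0, 0, xib))) has_real_derivative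
        B (0, 0, xib) u) (at 0)" by (simp add: B_def zero_prod_def[symmetric])
    then have "((\<lambda>s. 0) has_real_derivative B (0, 0, xib) u) (at 0)"
    proof (rule has_field_derivative_transform_within_open)
      show "open {-1 :: real<..}" "0 \<in> {-1 :: real<..}" by auto
      show "dir_deriv u a ((0, z0) + s *\<^sub>R (0, 0, xib)) = 0" if "s \<in> {-1<..}" for s
        using ray[of "1 + s" u] that by (simp add: z0_def xi_scale_def scaleR_add_left)
    qed
    then show ?thesis using DERIV_unique DERIV_const by blast
  qed
  \<comment> \<open>The differential of \<phi>0 kills the radial vector. The derivative of
    \<open>prj\<close> at \<open>z0\<close> only subtracts a radial component, so the homogeneous
    extension keeps the same differential there.\<close>
  have "n \<bullet> symplectic_J (0, xib) = 0"
    unfolding n using radial sym[of "(1, 0)" "(0, 0, xib)"] by simp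
  moreover have "dir_deriv v \<phi> z0 = n \<bullet> symplectic_J v - snd v \<bullet> xib / k * (n \<bullet> symplectic_J (0, xib))" for v
  proof -
    have "(prj has_derivative (\<lambda>v. v - (snd v \<bullet> xib / k) *\<^sub>R (0, xib))) (at z0)"
      unfolding prj_def z0_def using k
      by (auto intro!: derivative_eq_intros simp: k_def[symmetric] prod_eq_iff fun_eq_iff field_simps)
    moreover have "(\<phi>0 has_derivative (\<lambda>v. dir_deriv v \<phi>0 z0)) (at (prj z0))"
      unfolding prj_z0 by (rule has_derivative_dir_deriv[OF smooth_on_imp_differentiable[OF \<phi>0 N(2)]])
    ultimately have "(\<phi> has_derivative
        (\<lambda>v. dir_deriv (v - (snd v \<bullet> xib / k) *\<^sub>R (0, xib)) \<phi>0 z0)) (at z0)"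
      unfolding \<phi>_def by (rule has_derivative_compose)
    from dir_deriv_eq[OF this, of v] show ?thesis
      by (simp only: d\<phi>0 linear_diff[OF linear_J] linear_scale[OF linear_J] inner_diff_right
          inner_scaleR_right)
  qed
  ultimately have d\<phi>: "dir_deriv v \<phi> z0 = n \<bullet> symplectic_J v" for v by simp

  \<comment> \<open>The bracket estimate and the conic neighbourhood\<close>
  obtain \<kappa> where \<kappa>: "0 < \<kappa>" "\<kappa> < 1" and ev: "\<forall>\<^sub>F p in nhds (0, z0). 0 \<le> fst p \<longrightarrow>
       (poisson \<phi> (\<lambda>z. a (fst p, z)) (snd p))\<^sup>2 \<le> 4 * \<kappa> * a p"
  proof (rule poisson_bound[OF S sa _ crit(2) V1(1,3) \<phi> d\<phi>])
    show "0 \<le> a (t, z)" if "(t, z) \<in> S" "0 \<le> t" for t z using apos that by (simp add: S_def)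
    show "dir_deriv (0, n) (dir_deriv (0, n) a) (0, z0) < 2" using Bn by (simp add: B_def)
  qed blast
  obtain d where d: "d > 0" "\<And>t z. \<bar>t\<bar> < d \<Longrightarrow> dist z z0 < d \<Longrightarrow> 0 \<le> t \<Longrightarrow>
       (poisson \<phi> (\<lambda>z. a (t, z)) z)\<^sup>2 \<le> 4 * \<kappa> * a (t, z)"
    by (rule eventually_nhds_prod_box[OF ev]) auto
  \<comment> \<open>The closed ball inside \<open>V1 \<inter> N\<close> supplies the compactness for
    the derivative bounds below.\<close>
  have "open (V1 \<inter> N)" "z0 \<in> V1 \<inter> N" using V1 N by auto
  then obtain \<rho>1 where \<rho>1: "\<rho>1 > 0" "cball z0 \<rho>1 \<subseteq> V1 \<inter> N" by (meson open_contains_cball)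
  define \<rho> where "\<rho> = min \<rho>1 d"
  have \<rho>: "\<rho> > 0" "\<rho> \<le> d" "cball z0 \<rho> \<subseteq> V1 \<inter> N" using \<rho>1 d(1) by (auto simp: \<rho>_def)
  define V where "V = {z \<in> H. prj z \<in> ball z0 \<rho>}"
  \<comment> \<open>\<open>K\<close> bounds the fibre norm on the ball around \<open>z0\<close> and
    so compares a dilation factor with \<open>norm xi\<close>.\<close>
  define K where "K = norm xib + \<rho>"
  have K: "K > 0" using \<rho> by (simp add: K_def add_nonneg_pos)
  define \<delta> where "\<delta> = min r d"
  have \<delta>: "0 < \<delta>" "\<delta> \<le> r" "\<delta> \<le> d" "\<delta> \<le> T'" "\<delta> \<le> T" using cr d T' by (auto simp: \<delta>_def)
  have V: "open V" "conic_in_xi V" "z0 \<in> V"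
    using preimage[of "ball z0 \<rho>"] prj_z0 \<rho> by (auto simp: V_def)
  have sub: "V \<subseteq> V1" using \<rho> by (force simp: V_def V1_def)
  \<comment> \<open>Every point of \<open>V\<close> is a dilation of a point of the ball, where the
    local estimates hold.\<close>
  have base: "\<exists>l z'. l > 0 \<and> z = xi_scale l z' \<and> z' \<in> ball z0 \<rho> \<and> \<phi> z = \<phi>0 z' \<and> norm (snd z) \<le> l * K"
    if z: "z \<in> V" for z
  proof -
    define l where "l = snd z \<bullet> xib / k"
    have zH: "z \<in> H" and prj: "prj z \<in> ball z0 \<rho>" using z by (auto simp: V_def)
    have l: "l > 0" using zH k by (simp add: l_def H_def)
    have "norm (snd (prj z)) \<le> norm xib + norm (snd (prj z) - xib)"
      by (metis norm_triangle_sub)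
    also have "norm (snd (prj z) - xib) \<le> norm (prj z - z0)"
      using norm_snd_le[of "snd (prj z - z0)" "fst (prj z - z0)", unfolded prod.collapse]
      by (simp add: z0_def)
    also have "norm (prj z - z0) \<le> \<rho>" using prj by (simp add: dist_norm norm_minus_commute)
    finally have "norm (snd (prj z)) \<le> K" by (simp add: K_def)
    then have "norm (snd z) \<le> l * K"
      using l by (subst unprj[OF zH]) (simp add: l_def[symmetric] xi_scale_def)
    with l prj unprj[OF zH] show ?thesis
      by (intro exI[of _ l] exI[of _ "prj z"]) (simp add: l_def \<phi>_def)
  qed

  \<comment> \<open>Transport of the inequalities along rays\<close>
  have main: "a (t, z) \<ge> c / K\<^sup>2 * min (t\<^sup>2) ((t - \<phi> z)\<^sup>2) * (norm (snd z))\<^sup>2 \<and>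
        (poisson \<phi> (\<lambda>z. a (t, z)) z)\<^sup>2 \<le> 4 * \<kappa> * a (t, z)"
    if t: "t \<in> {0..<\<delta>}" and z: "z \<in> V" for t z
  proof -
    obtain l z' where l: "l > 0" and zz: "z = xi_scale l z'" and z': "z' \<in> ball z0 \<rho>"
      and \<phi>z: "\<phi> z = \<phi>0 z'" and nz: "norm (snd z) \<le> l * K" using base[OF z] by blast
    have z'N: "z' \<in> V1" "z' \<in> N" using z' \<rho>(3) by auto
    have tS: "(t, q) \<in> S" if "q \<in> V1" for q using that V1\<Omega> t \<delta> by (auto simp: S_def)
    have az: "a (t, z) = l\<^sup>2 * a (t, z')" unfolding zz by (rule ahom[OF tS[OF z'N(1)] l])
    define m where "m = min (t\<^sup>2) ((t - \<phi>0 z')\<^sup>2)"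
    have m: "m \<ge> 0" by (simp add: m_def)
    have "c / K\<^sup>2 * m * (norm (snd z))\<^sup>2 \<le> c / K\<^sup>2 * m * (l * K)\<^sup>2"
      using nz m cr(1) by (intro mult_left_mono power_mono) auto
    also have "\<dots> = l\<^sup>2 * (c * m)" using K by (simp add: power_mult_distrib)
    also have "\<dots> \<le> a (t, z)"
      unfolding az using lower[of t z'] t \<delta> z'N(2) by (intro mult_left_mono) (auto simp: m_def)
    finally have 1: "c / K\<^sup>2 * min (t\<^sup>2) ((t - \<phi> z)\<^sup>2) * (norm (snd z))\<^sup>2 \<le> a (t, z)"
      by (simp add: m_def \<phi>z)
    \<comment> \<open>The bracket has degree 0 + 2 - 1 = 1, so its square scales exactly like
      \<open>a\<close>.\<close>
    have "xi_homogeneous V1 2 (\<lambda>z. a (t, z))"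
      using ahom[OF tS] by (simp add: xi_homogeneous_def)
    from poisson_homogeneous[OF V1(1,2) \<phi>hom smooth_on_imp_differentiable[OF \<phi>] this]
      dir_deriv_snd_slice(1)[OF da(1)[OF tS]]
    have "xi_homogeneous V1 1 (poisson \<phi> (\<lambda>z. a (t, z)))" by simp
    then have "(poisson \<phi> (\<lambda>z. a (t, z)) z)\<^sup>2 = l\<^sup>2 * (poisson \<phi> (\<lambda>z. a (t, z)) z')\<^sup>2"
      unfolding zz using l z'N(1) by (simp add: xi_homogeneous_def power_mult_distrib)
    also have "\<dots> \<le> l\<^sup>2 * (4 * \<kappa> * a (t, z'))"
      using d(2)[of t z'] t \<delta> z' \<rho>(2) by (intro mult_left_mono) (auto simp: dist_commute)
    finally have "(poisson \<phi> (\<lambda>z. a (t, z)) z)\<^sup>2 \<le> 4 * \<kappa> * a (t, z)" by (simp add: az mult_ac)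
    with 1 show ?thesis by blast
  qed

  \<comment> \<open>Symbol estimates for the phase\<close>
  have bound: "\<exists>C. \<forall>x xi. (x, xi) \<in> V \<longrightarrow> norm xi \<ge> 1 \<longrightarrow>
        \<bar>multi_deriv dir_x \<alpha> (multi_deriv dir_xi \<beta> \<phi>) (x, xi)\<bar>
          \<le> C * jap xi powi (- int (\<Sum>j\<in>UNIV. \<beta> j))" for \<alpha> \<beta> :: "'d \<Rightarrow> nat"
  proof -
    define s where "s = (\<Sum>j\<in>UNIV. \<beta> j)"
    define g where "g = multi_deriv dir_x \<alpha> (multi_deriv dir_xi \<beta> \<phi>)"
    note 1 = multi_deriv_homogeneous(3,4)[OF V1(1,2) \<phi>hom \<phi>, of \<beta>]
    note 2 = multi_deriv_homogeneous(1,2)[OF V1(1,2) 1, of \<alpha>]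
    have g: "xi_homogeneous V1 (- int s) g" "smooth_on g V1" using 2 by (simp_all add: g_def s_def)
    \<comment> \<open>The derivative is bounded on the compact ball, and its homogeneity of degree
      \<open>- int s\<close> carries the bound to all of \<open>V\<close>.\<close>
    have "continuous_on (cball z0 \<rho>) g"
      using smooth_on_imp_continuous_on[OF g(2)] \<rho>(3) by (blast intro: continuous_on_subset)
    then have "bounded (g ` cball z0 \<rho>)" by (intro compact_imp_bounded compact_continuous_image) auto
    then obtain C where C: "\<And>z. z \<in> cball z0 \<rho> \<Longrightarrow> \<bar>g z\<bar> \<le> C"
      unfolding bounded_iff real_norm_def by blast
    have C0: "C \<ge> 0" using C[of z0] \<rho>(1) by force
    have "\<bar>g (x, xi)\<bar> \<le> C * (2 * K) ^ s * jap xi powi (- int s)" if z: "(x, xi) \<in> V" and xi: "norm xi \<ge> 1" for x xi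
    proof -
      obtain l z' where l: "l > 0" and zz: "(x, xi) = xi_scale l z'" and z': "z' \<in> ball z0 \<rho>"
        and nz: "norm xi \<le> l * K" using base[OF z] by auto
      have z'V: "z' \<in> V1" using z' \<rho>(3) by auto
      have jap: "jap xi > 0" by (simp add: jap_def add_pos_nonneg)
      \<comment> \<open>For \<open>norm xi \<ge> 1\<close> this converts the factor
        \<open>inverse (l ^ s)\<close> from homogeneity into a power of \<open>jap xi\<close>, at
        the cost of \<open>(2 * K) ^ s\<close>.\<close>
      have "jap xi \<le> l * (2 * K)" using jap_le[OF xi] nz by simp
      then have "jap xi ^ s \<le> l ^ s * (2 * K) ^ s"
        using jap by (metis power_mono power_mult_distrib less_imp_le)
      then have "inverse (l ^ s) \<le> (2 * K) ^ s * inverse (jap xi ^ s)"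
        using l jap by (simp add: field_simps)
      moreover have "\<bar>g (x, xi)\<bar> = inverse (l ^ s) * \<bar>g z'\<bar>"
        unfolding zz using g(1) z'V l
        by (simp add: xi_homogeneous_def power_int_minus abs_mult)
      moreover have "\<bar>g z'\<bar> \<le> C" using C z' by auto
      ultimately have "\<bar>g (x, xi)\<bar> \<le> ((2 * K) ^ s * inverse (jap xi ^ s)) * C"
        using l jap K by (auto intro!: mult_mono)
      then show ?thesis by (simp add: power_int_minus mult_ac)
    qed
    then show ?thesis unfolding g_def s_def by blast
  qed
  show ?thesis
  proof (rule exI[of _ V], rule exI[of _ \<phi>], rule exI[of _ \<kappa>], rule exI[of _ "c / K\<^sup>2"],
      rule exI[of _ \<delta>], intro conjI)
    show "open V" "(0, xib) \<in> V" "conic_in_xi V" using V by (auto simp: z0_def)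
    show "V \<subseteq> U \<times> (UNIV - {0})" using sub V1\<Omega> by (simp add: \<Omega>_def)
    show "smooth_on \<phi> V" by (rule smooth_on_subset[OF \<phi> sub])
    show "\<forall>x xi. \<forall>l>0. (x, xi) \<in> V \<longrightarrow> \<phi> (x, l *\<^sub>R xi) = \<phi> (x, xi)"
      using \<phi>hom sub by (force simp: xi_homogeneous_def xi_scale_def)
    show "0 < \<kappa>" "\<kappa> < 1" "0 < \<delta>" "\<delta> \<le> T" by fact+
    show "0 < c / K\<^sup>2" using cr K by simp
    show "\<forall>t x xi. t \<in> {0..<\<delta>} \<longrightarrow> (x, xi) \<in> V \<longrightarrow>
        a (t, x, xi) \<ge> c / K\<^sup>2 * min (t\<^sup>2) ((t - \<phi> (x, xi))\<^sup>2) * (norm xi)\<^sup>2 \<and>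
        (poisson \<phi> (\<lambda>z. a (t, z)) (x, xi))\<^sup>2 \<le> 4 * \<kappa> * a (t, x, xi)"
      using main by fastforce
    show "\<forall>\<alpha> \<beta> :: 'd \<Rightarrow> nat. \<exists>C. \<forall>x xi. (x, xi) \<in> V \<longrightarrow> norm xi \<ge> 1 \<longrightarrow>
        \<bar>multi_deriv dir_x \<alpha> (multi_deriv dir_xi \<beta> \<phi>) (x, xi)\<bar>
          \<le> C * jap xi powi (- int (\<Sum>j\<in>UNIV. \<beta> j))"
      using bound by blast
  qed
qed

end
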